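(* Let $A$ be a symmetric $\mathcal{O}$-algebra such that $K\otimes_{\mathcal{O}}A$ is split semisimple. Assume that $A$ has the projective scalar property and let $\pi^n1_A$ be a relative projective element with respect to some symmetrising form on $A$. (i) If $U$ is a Knörr $A$-lattice, then the $p$-part of the $\mathcal{O}$-rank of $U$ divides $\pi^n$ in $\mathcal{O}$. (ii) If $U$ is a nonzero projective $A$-lattice, then the $p$-part of the $\mathcal{O}$-rank of $U$ is divisible in $\mathcal{O}$ by $\pi^n$.
   Context: Let $p$ be a prime. $\mathcal{O}$ is a complete discrete valuation ring with maximal ideal $J(\mathcal{O})=\pi\mathcal{O}$, residue field $k=\mathcal{O}/J(\mathcal{O})$ of characteristic $p$, and field of fractions $K$ of characteristic $0$. An $\mathcal{O}$-algebra $A$ is symmetric if it is isomorphic to its $\mathcal{O}$-dual $A^*=\mathrm{Hom}_{\mathcal{O}}(A,\mathcal{O})$ as an $A$-$A$-bimodule (so $A$ is free of finite rank over $\mathcal{O}$). The image $s\in A^*$ of $1_A$ under a bimodule isomorphism $A\cong A^*$ is called a symmetrising form. Given a symmetrising form $s$ and an $\mathcal{O}$-basis $X$ of $A$ with dual basis $X^\vee=\{x^\vee : x\in X\}$ (that is, $s(xx^\vee)=1$ and $s(xy^\vee)=0$ for $x\ne y$ in $X$), the relative projective element of $A$ with respect to $s$ is $z_A=\sum_{x\in X}xx^\vee\in Z(A)$; it is independent of $X$. $A$ has the projective scalar property if there is a symmetrising form $s$ of $A$ whose relative projective element is $z_A=\lambda1_A$ for some $\lambda\in\mathcal{O}$.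 An $A$-lattice is a left unital $A$-module which is free of finite rank over $\mathcal{O}$. An indecomposable $A$-lattice $U$ is a Knörr lattice if the linear trace $\mathrm{tr}_U:\mathrm{End}_{\mathcal{O}}(U)\to\mathcal{O}$ satisfies $\mathrm{tr}_U(\alpha)\mathcal{O}\subseteq\mathrm{rk}_{\mathcal{O}}(U)\mathcal{O}$ for every $\alpha\in\mathrm{End}_A(U)$, with equality precisely when $\alpha$ is an automorphism. The $p$-part of a positive integer is the largest power of $p$ dividing it. *)

theory Defs
  imports "HOL-Algebra.Module" "HOL-Algebra.QuotRing" "HOL-Algebra.Ring_Divisibility"
    "HOL-Algebra.Free_Abelian_Groups" "HOL-Algebra.Generated_Groups"
    "HOL-Computational_Algebra.Primes"
begin

section \<open>The ground ring\<close>

definition has_characteristic :: "('a, 'm) ring_scheme \<Rightarrow> nat \<Rightarrow> bool" where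
  "has_characteristic R c \<longleftrightarrow> (\<forall>m::nat. [m] \<cdot>\<^bsub>R\<^esub> \<one>\<^bsub>R\<^esub> = \<zero>\<^bsub>R\<^esub> \<longleftrightarrow> c dvd m)"

definition discrete_valuation_ring :: "('o, 'm) ring_scheme \<Rightarrow> bool" where
  "discrete_valuation_ring R \<longleftrightarrow>
     principal_domain R \<and> \<not> field R \<and> (\<exists>!I. maximalideal I R)"

text \<open>Every Cauchy sequence for the \<open>\<pi>\<close>-adic topology converges.  Limits in a discrete
  valuation ring with uniformiser \<open>\<pi>\<close> are automatically unique.\<close>

definition adically_complete :: "('o, 'm) ring_scheme \<Rightarrow> 'o \<Rightarrow> bool" where
  "adically_complete R \<pi> \<longleftrightarrow>
     (\<forall>f :: nat \<Rightarrow> 'o. range f \<subseteq> carrier R \<longrightarrow>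
        (\<forall>N::nat. \<exists>M. \<forall>i\<ge>M. \<forall>j\<ge>M. f i \<ominus>\<^bsub>R\<^esub> f j \<in> PIdl\<^bsub>R\<^esub> (\<pi> [^]\<^bsub>R\<^esub> N)) \<longrightarrow>
        (\<exists>l\<in>carrier R. \<forall>N::nat. \<exists>M. \<forall>i\<ge>M. f i \<ominus>\<^bsub>R\<^esub> l \<in> PIdl\<^bsub>R\<^esub> (\<pi> [^]\<^bsub>R\<^esub> N)))"

text \<open>\<open>K\<close> is a field of fractions of \<open>R\<close>, with \<open>R\<close> embedded by \<open>\<iota>\<close>.\<close>

definition is_fraction_field ::
  "('o, 'm) ring_scheme \<Rightarrow> ('k, 'n) ring_scheme \<Rightarrow> ('o \<Rightarrow> 'k) \<Rightarrow> bool" where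
  "is_fraction_field R K \<iota> \<longleftrightarrow>
     field K \<and> \<iota> \<in> ring_hom R K \<and> inj_on \<iota> (carrier R) \<and>
     (\<forall>x\<in>carrier K. \<exists>a\<in>carrier R. \<exists>b\<in>carrier R - {\<zero>\<^bsub>R\<^esub>}. x = \<iota> a \<otimes>\<^bsub>K\<^esub> inv\<^bsub>K\<^esub> (\<iota> b))"

locale modular_system =
  fixes p :: nat and \<pi> :: 'o and R :: "('o, 'm) ring_scheme"
    and K :: "('k, 'n) ring_scheme" and \<iota> :: "'o \<Rightarrow> 'k"
  assumes prime_p: "Factorial_Ring.prime p"
    and dvr: "discrete_valuation_ring R"
    and uniformiser_closed: "\<pi> \<in> carrier R"
    and uniformiser: "maximalideal (PIdl\<^bsub>R\<^esub> \<pi>) R"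
    and complete: "adically_complete R \<pi>"
    and residue_char: "has_characteristic (R Quot PIdl\<^bsub>R\<^esub> \<pi>) p"
    and fraction_field: "is_fraction_field R K \<iota>"
    and fraction_char: "has_characteristic K 0"


section \<open>Modules and algebras\<close>

text \<open>The library locales \<open>module\<close> and \<open>algebra\<close> require a commutative ring of scalars and a
  commutative algebra, respectively; the following two locales drop these requirements.
  As in the library, a module is a record whose \<open>mult\<close> and \<open>one\<close> fields are irrelevant.\<close>

locale left_module = R?: ring R + M?: abelian_group M
  for R :: "('a, 'm) ring_scheme" (structure) and M :: "('a, 'u, 'n) module_scheme" (structure) +
  assumes smult_closed [simp, intro]:
      "\<lbrakk> a \<in> carrier R; x \<in> carrier M \<rbrakk> \<Longrightarrow> a \<odot>\<^bsub>M\<^esub> x \<in> carrier M"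
    and smult_l_distr:
      "\<lbrakk> a \<in> carrier R; b \<in> carrier R; x \<in> carrier M \<rbrakk> \<Longrightarrow>
      (a \<oplus> b) \<odot>\<^bsub>M\<^esub> x = a \<odot>\<^bsub>M\<^esub> x \<oplus>\<^bsub>M\<^esub> b \<odot>\<^bsub>M\<^esub> x"
    and smult_r_distr:
      "\<lbrakk> a \<in> carrier R; x \<in> carrier M; y \<in> carrier M \<rbrakk> \<Longrightarrow>
      a \<odot>\<^bsub>M\<^esub> (x \<oplus>\<^bsub>M\<^esub> y) = a \<odot>\<^bsub>M\<^esub> x \<oplus>\<^bsub>M\<^esub> a \<odot>\<^bsub>M\<^esub> y"
    and smult_assoc1:
      "\<lbrakk> a \<in> carrier R; b \<in> carrier R; x \<in> carrier M \<rbrakk> \<Longrightarrow>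
      (a \<otimes> b) \<odot>\<^bsub>M\<^esub> x = a \<odot>\<^bsub>M\<^esub> (b \<odot>\<^bsub>M\<^esub> x)"
    and smult_one [simp]:
      "x \<in> carrier M \<Longrightarrow> \<one> \<odot>\<^bsub>M\<^esub> x = x"

locale assoc_algebra = module R A + ring A for R (structure) and A (structure) +
  assumes smult_mult_left:
      "\<lbrakk> r \<in> carrier R; x \<in> carrier A; y \<in> carrier A \<rbrakk> \<Longrightarrow>
      (r \<odot>\<^bsub>A\<^esub> x) \<otimes>\<^bsub>A\<^esub> y = r \<odot>\<^bsub>A\<^esub> (x \<otimes>\<^bsub>A\<^esub> y)"
    and smult_mult_right:
      "\<lbrakk> r \<in> carrier R; x \<in> carrier A; y \<in> carrier A \<rbrakk> \<Longrightarrow>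
      x \<otimes>\<^bsub>A\<^esub> (r \<odot>\<^bsub>A\<^esub> y) = r \<odot>\<^bsub>A\<^esub> (x \<otimes>\<^bsub>A\<^esub> y)"

definition regular_module :: "('a, 'm) ring_scheme \<Rightarrow> ('a, 'a) module" where
  "regular_module A = \<lparr> carrier = carrier A, monoid.mult = mult A, one = one A,
     ring.zero = ring.zero A, ring.add = ring.add A, smult = mult A \<rparr>"

definition linear_maps :: "('a, 'm) ring_scheme \<Rightarrow> ('a, 'u, 'n) module_scheme \<Rightarrow>
    ('a, 'v, 'l) module_scheme \<Rightarrow> ('u \<Rightarrow> 'v) set" where
  "linear_maps A M N = {f \<in> carrier M \<rightarrow>\<^sub>E carrier N.
     (\<forall>x\<in>carrier M. \<forall>y\<in>carrier M. f (x \<oplus>\<^bsub>M\<^esub> y) = f x \<oplus>\<^bsub>N\<^esub> f y) \<and>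
     (\<forall>a\<in>carrier A. \<forall>x\<in>carrier M. f (a \<odot>\<^bsub>M\<^esub> x) = a \<odot>\<^bsub>N\<^esub> f x)}"

definition is_direct_sum :: "('a, 'u, 'm) module_scheme \<Rightarrow> 'u set \<Rightarrow> 'u set \<Rightarrow> bool" where
  "is_direct_sum M V W \<longleftrightarrow> V \<inter> W = {\<zero>\<^bsub>M\<^esub>} \<and> V <+>\<^bsub>M\<^esub> W = carrier M"

definition simple_module :: "('a, 'm) ring_scheme \<Rightarrow> ('a, 'u, 'n) module_scheme \<Rightarrow> bool" where
  "simple_module A M \<longleftrightarrow> left_module A M \<and> carrier M \<noteq> {\<zero>\<^bsub>M\<^esub>} \<and>
     (\<forall>V. submodule V A M \<longrightarrow> V = {\<zero>\<^bsub>M\<^esub>} \<or> V = carrier M)"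

definition indecomposable_module ::
  "('a, 'm) ring_scheme \<Rightarrow> ('a, 'u, 'n) module_scheme \<Rightarrow> bool" where
  "indecomposable_module A M \<longleftrightarrow> carrier M \<noteq> {\<zero>\<^bsub>M\<^esub>} \<and>
     (\<forall>V W. submodule V A M \<longrightarrow> submodule W A M \<longrightarrow> is_direct_sum M V W \<longrightarrow>
        V = {\<zero>\<^bsub>M\<^esub>} \<or> W = {\<zero>\<^bsub>M\<^esub>})"

text \<open>The free module \<open>A\<^sup>m\<close>; the \<open>mult\<close> and \<open>one\<close> fields are dummies.\<close>

definition free_module :: "('a, 'm) ring_scheme \<Rightarrow> nat \<Rightarrow> ('a, nat \<Rightarrow> 'a) module" where
  "free_module A m = \<lparr> carrier = {..<m} \<rightarrow>\<^sub>E carrier A,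
     monoid.mult = (\<lambda>f g. \<lambda>i\<in>{..<m}. f i \<otimes>\<^bsub>A\<^esub> g i), one = (\<lambda>i\<in>{..<m}. \<one>\<^bsub>A\<^esub>),
     ring.zero = (\<lambda>i\<in>{..<m}. \<zero>\<^bsub>A\<^esub>), ring.add = (\<lambda>f g. \<lambda>i\<in>{..<m}. f i \<oplus>\<^bsub>A\<^esub> g i),
     smult = (\<lambda>a f. \<lambda>i\<in>{..<m}. a \<otimes>\<^bsub>A\<^esub> f i) \<rparr>"

text \<open>Finitely generated projective modules: those isomorphic to a direct summand of a free
  module of finite rank.  Every lattice is finitely generated.\<close>

definition fg_projective :: "('a, 'm) ring_scheme \<Rightarrow> ('a, 'u, 'n) module_scheme \<Rightarrow> bool" where
  "fg_projective A M \<longleftrightarrow> left_module A M \<and>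
     (\<exists>m V W. submodule V A (free_module A m) \<and> submodule W A (free_module A m) \<and>
        is_direct_sum (free_module A m) V W \<and>
        (\<exists>f \<in> linear_maps A M ((free_module A m)\<lparr>carrier := V\<rparr>). bij_betw f (carrier M) V))"


section \<open>Bases, rank and trace over a commutative ring\<close>

definition is_basis :: "('o, 'm) ring_scheme \<Rightarrow> ('o, 'u, 'n) module_scheme \<Rightarrow> 'u set \<Rightarrow> bool" where
  "is_basis R M X \<longleftrightarrow> finite X \<and> X \<subseteq> carrier M \<and>
     (\<forall>v\<in>carrier M. \<exists>!c. c \<in> X \<rightarrow>\<^sub>E carrier R \<and> v = (\<Oplus>\<^bsub>M\<^esub>x\<in>X. c x \<odot>\<^bsub>M\<^esub> x))"

definition coords ::
  "('o, 'm) ring_scheme \<Rightarrow> ('o, 'u, 'n) module_scheme \<Rightarrow> 'u set \<Rightarrow> 'u \<Rightarrow> 'u \<Rightarrow> 'o" where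
  "coords R M X v = (THE c. c \<in> X \<rightarrow>\<^sub>E carrier R \<and> v = (\<Oplus>\<^bsub>M\<^esub>x\<in>X. c x \<odot>\<^bsub>M\<^esub> x))"

definition free_of_finite_rank ::
  "('o, 'm) ring_scheme \<Rightarrow> ('o, 'u, 'n) module_scheme \<Rightarrow> bool" where
  "free_of_finite_rank R M \<longleftrightarrow> (\<exists>X. is_basis R M X)"

text \<open>Over a nonzero commutative ring neither the rank nor the trace depends on the basis.\<close>

definition some_basis :: "('o, 'm) ring_scheme \<Rightarrow> ('o, 'u, 'n) module_scheme \<Rightarrow> 'u set" where
  "some_basis R M = (SOME X. is_basis R M X)"

definition rank :: "('o, 'm) ring_scheme \<Rightarrow> ('o, 'u, 'n) module_scheme \<Rightarrow> nat" where
  "rank R M = card (some_basis R M)"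

definition linear_trace ::
  "('o, 'm) ring_scheme \<Rightarrow> ('o, 'u, 'n) module_scheme \<Rightarrow> ('u \<Rightarrow> 'u) \<Rightarrow> 'o" where
  "linear_trace R M \<alpha> =
     (\<Oplus>\<^bsub>R\<^esub>x\<in>some_basis R M. coords R M (some_basis R M) (\<alpha> x) x)"


section \<open>Scalar extension and split semisimple algebras\<close>

text \<open>The integral monoid ring of the product of the multiplicative monoids of \<open>K\<close> and \<open>A\<close>,
  whose additive group is the free abelian group on \<open>K \<times> A\<close>.\<close>

definition pair_ring :: "('k, 'm) ring_scheme \<Rightarrow> ('a, 'n) ring_scheme \<Rightarrow> ('k \<times> 'a \<Rightarrow>\<^sub>0 int) ring" where
  "pair_ring K A = \<lparr> carrier = carrier (free_Abelian_group (carrier K \<times> carrier A)),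
     monoid.mult = (\<lambda>u v. frag_extend (\<lambda>(c, a). frag_extend
        (\<lambda>(d, b). frag_of (c \<otimes>\<^bsub>K\<^esub> d, a \<otimes>\<^bsub>A\<^esub> b)) v) u),
     one = frag_of (\<one>\<^bsub>K\<^esub>, \<one>\<^bsub>A\<^esub>), ring.zero = 0, ring.add = (+) \<rparr>"

definition tensor_relations :: "('o, 'l) ring_scheme \<Rightarrow> ('k, 'm) ring_scheme \<Rightarrow> ('o \<Rightarrow> 'k) \<Rightarrow>
    ('o, 'a, 'n) module_scheme \<Rightarrow> ('k \<times> 'a \<Rightarrow>\<^sub>0 int) set" where
  "tensor_relations R K \<iota> A =
     {frag_of (c \<oplus>\<^bsub>K\<^esub> d, a) - frag_of (c, a) - frag_of (d, a) | c d a.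
        c \<in> carrier K \<and> d \<in> carrier K \<and> a \<in> carrier A} \<union>
     {frag_of (c, a \<oplus>\<^bsub>A\<^esub> b) - frag_of (c, a) - frag_of (c, b) | c a b.
        c \<in> carrier K \<and> a \<in> carrier A \<and> b \<in> carrier A} \<union>
     {frag_of (c \<otimes>\<^bsub>K\<^esub> \<iota> r, a) - frag_of (c, r \<odot>\<^bsub>A\<^esub> a) | c r a.
        c \<in> carrier K \<and> r \<in> carrier R \<and> a \<in> carrier A}"

definition tensor_kernel :: "('o, 'l) ring_scheme \<Rightarrow> ('k, 'm) ring_scheme \<Rightarrow> ('o \<Rightarrow> 'k) \<Rightarrow>
    ('o, 'a, 'n) module_scheme \<Rightarrow> ('k \<times> 'a \<Rightarrow>\<^sub>0 int) set" where
  "tensor_kernel R K \<iota> A =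
     generate (free_Abelian_group (carrier K \<times> carrier A)) (tensor_relations R K \<iota> A)"

text \<open>The \<open>K\<close>-algebra \<open>K \<otimes>\<^sub>R A\<close>.  The subgroup generated by the relations of the tensor product is
  an ideal of \<open>pair_ring K A\<close>, and \<open>(c \<otimes> a) (d \<otimes> b) = c d \<otimes> a b\<close>, \<open>c (d \<otimes> b) = c d \<otimes> b\<close>.\<close>

definition scalar_extension :: "('o, 'l) ring_scheme \<Rightarrow> ('k, 'm) ring_scheme \<Rightarrow> ('o \<Rightarrow> 'k) \<Rightarrow>
    ('o, 'a, 'n) module_scheme \<Rightarrow> ('k, ('k \<times> 'a \<Rightarrow>\<^sub>0 int) set) module" where
  "scalar_extension R K \<iota> A =
     (let F = pair_ring K A; N = tensor_kernel R K \<iota> A; Q = F Quot N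
      in \<lparr> carrier = carrier Q, monoid.mult = mult Q, one = one Q,
           ring.zero = ring.zero Q, ring.add = ring.add Q,
           smult = (\<lambda>c u. (N +>\<^bsub>F\<^esub> frag_of (c, \<one>\<^bsub>A\<^esub>)) \<otimes>\<^bsub>Q\<^esub> u) \<rparr>)"

definition semisimple_ring :: "('b, 'm) ring_scheme \<Rightarrow> bool" where
  "semisimple_ring B \<longleftrightarrow> ring B \<and>
     (\<forall>V. submodule V B (regular_module B) \<longrightarrow>
        (\<exists>W. submodule W B (regular_module B) \<and> is_direct_sum (regular_module B) V W))"

text \<open>A simple module over \<open>B\<close> is a quotient of the regular module, hence isomorphic to one
  whose carrier is a set of elements of the type \<open>'b\<close>; so it is enough to let \<open>S\<close> range over
  modules carried by that type.\<close>

definition split_algebra :: "('k, 'm) ring_scheme \<Rightarrow> ('k, 'b, 'n) module_scheme \<Rightarrow> bool" where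
  "split_algebra K B \<longleftrightarrow>
     (\<forall>S :: ('b, 'b) module. simple_module B S \<longrightarrow>
        (\<forall>f \<in> linear_maps B S S. \<exists>c\<in>carrier K. \<forall>x\<in>carrier S.
            f x = (c \<odot>\<^bsub>B\<^esub> \<one>\<^bsub>B\<^esub>) \<odot>\<^bsub>S\<^esub> x))"

definition split_semisimple :: "('k, 'm) ring_scheme \<Rightarrow> ('k, 'b, 'n) module_scheme \<Rightarrow> bool" where
  "split_semisimple K B \<longleftrightarrow> semisimple_ring B \<and> split_algebra K B"


section \<open>Symmetric algebras\<close>

definition dual_space :: "('o, 'm) ring_scheme \<Rightarrow> ('o, 'a, 'n) module_scheme \<Rightarrow> ('a \<Rightarrow> 'o) set" where
  "dual_space R A = linear_maps R A (regular_module R)"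

text \<open>Isomorphisms \<open>A \<rightarrow> A\<^sup>*\<close> of \<open>A\<close>-\<open>A\<close>-bimodules, where \<open>(a f)(z) = f (z a)\<close> and
  \<open>(f a)(z) = f (a z)\<close>.\<close>

definition dual_bimodule_iso ::
  "('o, 'm) ring_scheme \<Rightarrow> ('o, 'a, 'n) module_scheme \<Rightarrow> ('a \<Rightarrow> 'a \<Rightarrow> 'o) \<Rightarrow> bool" where
  "dual_bimodule_iso R A \<Phi> \<longleftrightarrow>
     bij_betw \<Phi> (carrier A) (dual_space R A) \<and>
     (\<forall>x\<in>carrier A. \<forall>y\<in>carrier A. \<forall>z\<in>carrier A. \<Phi> (x \<oplus>\<^bsub>A\<^esub> y) z = \<Phi> x z \<oplus>\<^bsub>R\<^esub> \<Phi> y z) \<and>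
     (\<forall>a\<in>carrier A. \<forall>x\<in>carrier A. \<forall>z\<in>carrier A. \<Phi> (a \<otimes>\<^bsub>A\<^esub> x) z = \<Phi> x (z \<otimes>\<^bsub>A\<^esub> a)) \<and>
     (\<forall>a\<in>carrier A. \<forall>x\<in>carrier A. \<forall>z\<in>carrier A. \<Phi> (x \<otimes>\<^bsub>A\<^esub> a) z = \<Phi> x (a \<otimes>\<^bsub>A\<^esub> z))"

definition symmetric_algebra :: "('o, 'm) ring_scheme \<Rightarrow> ('o, 'a, 'n) module_scheme \<Rightarrow> bool" where
  "symmetric_algebra R A \<longleftrightarrow>
     assoc_algebra R A \<and> free_of_finite_rank R A \<and> (\<exists>\<Phi>. dual_bimodule_iso R A \<Phi>)"

definition symmetrising_form ::
  "('o, 'm) ring_scheme \<Rightarrow> ('o, 'a, 'n) module_scheme \<Rightarrow> ('a \<Rightarrow> 'o) \<Rightarrow> bool" where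
  "symmetrising_form R A s \<longleftrightarrow> (\<exists>\<Phi>. dual_bimodule_iso R A \<Phi> \<and> s = \<Phi> \<one>\<^bsub>A\<^esub>)"

text \<open>\<open>d x\<close> is the element \<open>x\<^sup>\<or>\<close> of the dual basis.\<close>

definition is_dual_basis :: "('o, 'm) ring_scheme \<Rightarrow> ('o, 'a, 'n) module_scheme \<Rightarrow>
    ('a \<Rightarrow> 'o) \<Rightarrow> 'a set \<Rightarrow> ('a \<Rightarrow> 'a) \<Rightarrow> bool" where
  "is_dual_basis R A s X d \<longleftrightarrow> d \<in> X \<rightarrow> carrier A \<and>
     (\<forall>x\<in>X. \<forall>y\<in>X. s (x \<otimes>\<^bsub>A\<^esub> d y) = (if x = y then \<one>\<^bsub>R\<^esub> else \<zero>\<^bsub>R\<^esub>))"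

text \<open>The element is independent of the basis, so this relation determines \<open>z\<close> from \<open>s\<close>.\<close>

definition relative_projective_element :: "('o, 'm) ring_scheme \<Rightarrow>
    ('o, 'a, 'n) module_scheme \<Rightarrow> ('a \<Rightarrow> 'o) \<Rightarrow> 'a \<Rightarrow> bool" where
  "relative_projective_element R A s z \<longleftrightarrow>
     (\<exists>X d. is_basis R A X \<and> is_dual_basis R A s X d \<and> z = (\<Oplus>\<^bsub>A\<^esub>x\<in>X. x \<otimes>\<^bsub>A\<^esub> d x))"

definition projective_scalar_property ::
  "('o, 'm) ring_scheme \<Rightarrow> ('o, 'a, 'n) module_scheme \<Rightarrow> bool" where
  "projective_scalar_property R A \<longleftrightarrow>
     (\<exists>s. symmetrising_form R A s \<and>
        (\<exists>l\<in>carrier R. relative_projective_element R A s (l \<odot>\<^bsub>A\<^esub> \<one>\<^bsub>A\<^esub>)))"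


section \<open>Lattices\<close>

text \<open>The \<open>R\<close>-module underlying a module \<open>U\<close> over the \<open>R\<close>-algebra \<open>A\<close>.\<close>

definition restrict_scalars :: "('o, 'a, 'n) module_scheme \<Rightarrow> ('a, 'u, 'l) module_scheme \<Rightarrow>
    ('o, 'u) module" where
  "restrict_scalars A U = \<lparr> carrier = carrier U, monoid.mult = mult U, one = one U,
     ring.zero = ring.zero U, ring.add = ring.add U,
     smult = (\<lambda>r u. (r \<odot>\<^bsub>A\<^esub> \<one>\<^bsub>A\<^esub>) \<odot>\<^bsub>U\<^esub> u) \<rparr>"

definition lattice_over :: "('o, 'm) ring_scheme \<Rightarrow> ('o, 'a, 'n) module_scheme \<Rightarrow>
    ('a, 'u, 'l) module_scheme \<Rightarrow> bool" where
  "lattice_over R A U \<longleftrightarrow> left_module A U \<and> free_of_finite_rank R (restrict_scalars A U)"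

definition lattice_rank :: "('o, 'm) ring_scheme \<Rightarrow> ('o, 'a, 'n) module_scheme \<Rightarrow>
    ('a, 'u, 'l) module_scheme \<Rightarrow> nat" where
  "lattice_rank R A U = rank R (restrict_scalars A U)"

definition knorr_lattice :: "('o, 'm) ring_scheme \<Rightarrow> ('o, 'a, 'n) module_scheme \<Rightarrow>
    ('a, 'u, 'l) module_scheme \<Rightarrow> bool" where
  "knorr_lattice R A U \<longleftrightarrow> lattice_over R A U \<and> indecomposable_module A U \<and>
     (\<forall>\<alpha> \<in> linear_maps A U U.
        let t = linear_trace R (restrict_scalars A U) \<alpha>;
            r = [lattice_rank R A U] \<cdot>\<^bsub>R\<^esub> \<one>\<^bsub>R\<^esub>
        in PIdl\<^bsub>R\<^esub> t \<subseteq> PIdl\<^bsub>R\<^esub> r \<and>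
           (PIdl\<^bsub>R\<^esub> t = PIdl\<^bsub>R\<^esub> r \<longleftrightarrow> bij_betw \<alpha> (carrier U) (carrier U)))"

definition p_part :: "nat \<Rightarrow> nat \<Rightarrow> nat" where
  "p_part p m = p ^ multiplicity p m"

end

theory Submission
  imports Defs
begin

text \<open>The proof rests on one trace formula.  Let \<open>X\<close> be a basis of \<open>A\<close> with dual basis \<open>x\<^sup>\<or> = d x\<close>
  with respect to \<open>s\<close>, and let \<open>z\<close> be the sum of the elements \<open>x x\<^sup>\<or>\<close>.  For an \<open>A\<close>-lattice \<open>U\<close>, a
  linear form \<open>l\<close> on \<open>U\<close> and \<open>b \<in> U\<close>, average the rank one endomorphism \<open>u \<mapsto> l(u) b\<close> to
  \<open>T(u) = \<Sum>\<^sub>x l(x\<^sup>\<or> u) x b\<close>.  This is again a sum of rank one maps, so its trace is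
  \<open>\<Sum>\<^sub>x l(x\<^sup>\<or> x b)\<close>, which is \<open>l(z b)\<close> because \<open>s\<close> is symmetric (\<open>casimir_flip\<close>).  When \<open>z\<close> is the
  scalar \<open>\<pi>\<^sup>n\<close>, the trace of \<open>T\<close> is therefore \<open>\<pi>\<^sup>n l(b)\<close> (\<open>linear_trace_relative_trace\<close>).

  For a Knorr lattice, let \<open>b\<close> be a basis element and \<open>l\<close> its coordinate form.  Then \<open>T\<close> is an
  \<open>A\<close>-endomorphism with trace \<open>\<pi>\<^sup>n\<close>, so the defining property of Knorr lattices says that the
  rank of \<open>U\<close> divides \<open>\<pi>\<^sup>n\<close> (\<open>knorr_rank_divides\<close>).

  For a projective lattice, a splitting of a surjection from a free module yields \<open>A\<close>-linear maps
  \<open>\<phi>\<^sub>j : U \<rightarrow> A\<close> and \<open>v\<^sub>j \<in> U\<close> with \<open>u = \<Sum>\<^sub>j \<phi>\<^sub>j(u) v\<^sub>j\<close>.  Expanding \<open>\<phi>\<^sub>j(u)\<close> in the basis \<open>X\<close> exhibits the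
  identity of \<open>U\<close> as the sum of the averaged maps for \<open>l = s \<circ> \<phi>\<^sub>j\<close> and \<open>b = v\<^sub>j\<close>.  Its trace, the rank of
  \<open>U\<close>, is then a multiple of \<open>\<pi>\<^sup>n\<close> (\<open>divides_projective_rank\<close>).

  Finally, integers prime to \<open>p\<close> are units of the local ring \<open>R\<close>, so the rank and its \<open>p\<close>-part are
  associated (\<open>integer_associated_p_part\<close>), and either divisibility passes from one to the other.\<close>

section \<open>Additive maps and finite sums\<close>

lemma additive_finsum:
  assumes M: "abelian_group M" and N: "abelian_group N"
    and f: "f \<in> carrier M \<rightarrow> carrier N"
    and add: "\<And>x y. \<lbrakk>x \<in> carrier M; y \<in> carrier M\<rbrakk> \<Longrightarrow> f (x \<oplus>\<^bsub>M\<^esub> y) = f x \<oplus>\<^bsub>N\<^esub> f y"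
    and g: "g \<in> I \<rightarrow> carrier M"
  shows "f (\<Oplus>\<^bsub>M\<^esub>i\<in>I. g i) = (\<Oplus>\<^bsub>N\<^esub>i\<in>I. f (g i))"
proof -
  interpret M: abelian_group M by (rule M)
  interpret N: abelian_group N by (rule N)
  have f_closed: "f x \<in> carrier N" if "x \<in> carrier M" for x
    using f that by blast
  have "f \<zero>\<^bsub>M\<^esub> \<oplus>\<^bsub>N\<^esub> f \<zero>\<^bsub>M\<^esub> = f \<zero>\<^bsub>M\<^esub>"
    using add[of "\<zero>\<^bsub>M\<^esub>" "\<zero>\<^bsub>M\<^esub>"] by simp
  then have zero: "f \<zero>\<^bsub>M\<^esub> = \<zero>\<^bsub>N\<^esub>"
    by (simp add: f_closed)
  show ?thesis
    using g
  proof (induction I rule: infinite_finite_induct)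
    case (insert i I)
    then have "g \<in> I \<rightarrow> carrier M" "g i \<in> carrier M" by auto
    then show ?case
      using insert by (simp add: f_closed Pi_iff add)
  qed (simp_all add: zero)
qed

lemma (in abelian_monoid) finsum_swap:
  assumes "finite I" and "finite J"
    and "\<And>i j. \<lbrakk>i \<in> I; j \<in> J\<rbrakk> \<Longrightarrow> f i j \<in> carrier G"
  shows "(\<Oplus>i\<in>I. \<Oplus>j\<in>J. f i j) = (\<Oplus>j\<in>J. \<Oplus>i\<in>I. f i j)"
  using assms(1,3)
proof (induction I rule: finite_induct)
  case empty
  then show ?case by simp
next
  case (insert i I)
  have "(\<Oplus>j\<in>J. \<Oplus>i\<in>insert i I. f i j) = (\<Oplus>j\<in>J. f i j \<oplus> (\<Oplus>i\<in>I. f i j))"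
    using insert by (intro finsum_cong') (auto simp: Pi_iff)
  also have "\<dots> = (\<Oplus>j\<in>J. f i j) \<oplus> (\<Oplus>j\<in>J. \<Oplus>i\<in>I. f i j)"
    using insert by (intro finsum_addf) (auto simp: Pi_iff)
  finally show ?case
    using insert by (simp add: Pi_iff)
qed

section \<open>Coordinates and traces\<close>

lemma dual_spaceD:
  assumes "l \<in> dual_space R M"
  shows "x \<in> carrier M \<Longrightarrow> l x \<in> carrier R"
    and "\<lbrakk>x \<in> carrier M; y \<in> carrier M\<rbrakk> \<Longrightarrow> l (x \<oplus>\<^bsub>M\<^esub> y) = l x \<oplus>\<^bsub>R\<^esub> l y"
    and "\<lbrakk>r \<in> carrier R; x \<in> carrier M\<rbrakk> \<Longrightarrow> l (r \<odot>\<^bsub>M\<^esub> x) = r \<otimes>\<^bsub>R\<^esub> l x"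
  using assms by (auto simp: dual_space_def linear_maps_def regular_module_def)

lemma dual_spaceI:
  assumes "\<And>x. x \<in> carrier M \<Longrightarrow> l x \<in> carrier R"
    and "\<And>x y. \<lbrakk>x \<in> carrier M; y \<in> carrier M\<rbrakk> \<Longrightarrow> l (x \<oplus>\<^bsub>M\<^esub> y) = l x \<oplus>\<^bsub>R\<^esub> l y"
    and "\<And>r x. \<lbrakk>r \<in> carrier R; x \<in> carrier M\<rbrakk> \<Longrightarrow> l (r \<odot>\<^bsub>M\<^esub> x) = r \<otimes>\<^bsub>R\<^esub> l x"
    and "\<And>x y. \<lbrakk>x \<in> carrier M; y \<in> carrier M\<rbrakk> \<Longrightarrow> x \<oplus>\<^bsub>M\<^esub> y \<in> carrier M"
    and "\<And>r x. \<lbrakk>r \<in> carrier R; x \<in> carrier M\<rbrakk> \<Longrightarrow> r \<odot>\<^bsub>M\<^esub> x \<in> carrier M"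
  shows "restrict l (carrier M) \<in> dual_space R M"
  using assms by (auto simp: dual_space_def linear_maps_def regular_module_def)

context module
begin

lemma dual_space_finsum:
  assumes l: "l \<in> dual_space R M" and v: "v \<in> I \<rightarrow> carrier M"
  shows "l (\<Oplus>\<^bsub>M\<^esub>i\<in>I. v i) = (\<Oplus>i\<in>I. l (v i))"
  by (rule additive_finsum[OF M.abelian_group_axioms R.abelian_group_axioms])
    (use v in \<open>auto simp: dual_spaceD[OF l]\<close>)

lemma dual_space_lincomb:
  assumes l: "l \<in> dual_space R M" and c: "c \<in> I \<rightarrow> carrier R" and v: "v \<in> I \<rightarrow> carrier M"
  shows "l (\<Oplus>\<^bsub>M\<^esub>i\<in>I. c i \<odot>\<^bsub>M\<^esub> v i) = (\<Oplus>i\<in>I. c i \<otimes> l (v i))"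
proof -
  have "l (\<Oplus>\<^bsub>M\<^esub>i\<in>I. c i \<odot>\<^bsub>M\<^esub> v i) = (\<Oplus>i\<in>I. l (c i \<odot>\<^bsub>M\<^esub> v i))"
    by (rule dual_space_finsum) (use l c v in auto)
  also have "\<dots> = (\<Oplus>i\<in>I. c i \<otimes> l (v i))"
    by (rule R.finsum_cong') (use c v in \<open>auto simp: dual_spaceD[OF l] Pi_iff\<close>)
  finally show ?thesis .
qed

lemma coords_basis:
  assumes "is_basis R M B" and "v \<in> carrier M"
  shows coords_PiE: "coords R M B v \<in> B \<rightarrow>\<^sub>E carrier R"
    and coords_expand: "(\<Oplus>\<^bsub>M\<^esub>b\<in>B. coords R M B v b \<odot>\<^bsub>M\<^esub> b) = v"
proof -
  have "\<exists>!c. c \<in> B \<rightarrow>\<^sub>E carrier R \<and> v = (\<Oplus>\<^bsub>M\<^esub>b\<in>B. c b \<odot>\<^bsub>M\<^esub> b)"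
    using assms by (auto simp: is_basis_def)
  from theI'[OF this, folded coords_def]
  show "coords R M B v \<in> B \<rightarrow>\<^sub>E carrier R"
    and "(\<Oplus>\<^bsub>M\<^esub>b\<in>B. coords R M B v b \<odot>\<^bsub>M\<^esub> b) = v"
    by simp_all
qed

lemma coords_unique:
  assumes B: "is_basis R M B" and c: "c \<in> B \<rightarrow> carrier R"
    and v: "v = (\<Oplus>\<^bsub>M\<^esub>b\<in>B. c b \<odot>\<^bsub>M\<^esub> b)" and b: "b \<in> B"
  shows "coords R M B v b = c b"
proof -
  have sub: "B \<subseteq> carrier M"
    using B by (auto simp: is_basis_def)
  have v_mem: "v \<in> carrier M"
    unfolding v using c sub by (intro M.finsum_closed) (auto simp: Pi_iff subset_iff)
  have "v = (\<Oplus>\<^bsub>M\<^esub>b\<in>B. restrict c B b \<odot>\<^bsub>M\<^esub> b)"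
    unfolding v using c sub by (intro M.finsum_cong') (auto simp: Pi_iff subset_iff)
  moreover have "restrict c B \<in> B \<rightarrow>\<^sub>E carrier R"
    using c by auto
  moreover have "\<exists>!c. c \<in> B \<rightarrow>\<^sub>E carrier R \<and> v = (\<Oplus>\<^bsub>M\<^esub>b\<in>B. c b \<odot>\<^bsub>M\<^esub> b)"
    using B v_mem by (auto simp: is_basis_def)
  ultimately have "coords R M B v = restrict c B"
    using coords_PiE[OF B v_mem] coords_expand[OF B v_mem] by metis
  then show ?thesis
    using b by simp
qed

lemma coords_basis_element:
  assumes B: "is_basis R M B" and b: "b \<in> B" and b': "b' \<in> B"
  shows "coords R M B b b' = (if b = b' then \<one> else \<zero>)"
proof (rule coords_unique[OF B])
  have sub: "B \<subseteq> carrier M" and fin: "finite B"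
    using B by (auto simp: is_basis_def)
  have "(\<Oplus>\<^bsub>M\<^esub>b'\<in>B. (if b = b' then \<one> else \<zero>) \<odot>\<^bsub>M\<^esub> b') = (\<Oplus>\<^bsub>M\<^esub>b'\<in>B. if b = b' then b' else \<zero>\<^bsub>M\<^esub>)"
    by (rule M.finsum_cong') (use sub in auto)
  also have "\<dots> = b"
    by (rule M.finsum_singleton[OF b fin]) (use sub in auto)
  finally show "b = (\<Oplus>\<^bsub>M\<^esub>b'\<in>B. (if b = b' then \<one> else \<zero>) \<odot>\<^bsub>M\<^esub> b')" ..
qed (use b' in auto)

lemma coords_in_dual_space:
  assumes B: "is_basis R M B" and b: "b \<in> B"
  shows "(\<lambda>v\<in>carrier M. coords R M B v b) \<in> dual_space R M"
proof (rule dual_spaceI)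
  have sub: "B \<subseteq> carrier M"
    using B by (auto simp: is_basis_def)
  have closed: "coords R M B v b \<in> carrier R" if "v \<in> carrier M" "b \<in> B" for v b
    using coords_PiE[OF B that(1)] that(2) by auto
  show "coords R M B v b \<in> carrier R" if "v \<in> carrier M" for v
    using closed[OF that b] .
  show "coords R M B (v \<oplus>\<^bsub>M\<^esub> w) b = coords R M B v b \<oplus> coords R M B w b"
    if v: "v \<in> carrier M" and w: "w \<in> carrier M" for v w
  proof (rule coords_unique[OF B _ _ b])
    have "v \<oplus>\<^bsub>M\<^esub> w = (\<Oplus>\<^bsub>M\<^esub>b\<in>B. coords R M B v b \<odot>\<^bsub>M\<^esub> b) \<oplus>\<^bsub>M\<^esub> (\<Oplus>\<^bsub>M\<^esub>b\<in>B. coords R M B w b \<odot>\<^bsub>M\<^esub> b)"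
      using coords_expand[OF B v] coords_expand[OF B w] by simp
    also have "\<dots> = (\<Oplus>\<^bsub>M\<^esub>b\<in>B. coords R M B v b \<odot>\<^bsub>M\<^esub> b \<oplus>\<^bsub>M\<^esub> coords R M B w b \<odot>\<^bsub>M\<^esub> b)"
      by (rule M.finsum_addf[symmetric]) (use sub v w closed in auto)
    also have "\<dots> = (\<Oplus>\<^bsub>M\<^esub>b\<in>B. (coords R M B v b \<oplus> coords R M B w b) \<odot>\<^bsub>M\<^esub> b)"
      by (rule M.finsum_cong') (use sub v w closed in \<open>auto simp: smult_l_distr subset_iff\<close>)
    finally show "v \<oplus>\<^bsub>M\<^esub> w = (\<Oplus>\<^bsub>M\<^esub>b\<in>B. (coords R M B v b \<oplus> coords R M B w b) \<odot>\<^bsub>M\<^esub> b)" .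
  qed (use v w closed in auto)
  show "coords R M B (r \<odot>\<^bsub>M\<^esub> v) b = r \<otimes> coords R M B v b"
    if r: "r \<in> carrier R" and v: "v \<in> carrier M" for r v
  proof (rule coords_unique[OF B _ _ b])
    have "r \<odot>\<^bsub>M\<^esub> v = r \<odot>\<^bsub>M\<^esub> (\<Oplus>\<^bsub>M\<^esub>b\<in>B. coords R M B v b \<odot>\<^bsub>M\<^esub> b)"
      using coords_expand[OF B v] by simp
    also have "\<dots> = (\<Oplus>\<^bsub>M\<^esub>b\<in>B. r \<odot>\<^bsub>M\<^esub> (coords R M B v b \<odot>\<^bsub>M\<^esub> b))"
      by (rule additive_finsum[OF M.abelian_group_axioms M.abelian_group_axioms])
        (use sub r v closed in \<open>auto simp: smult_r_distr subset_iff\<close>)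
    also have "\<dots> = (\<Oplus>\<^bsub>M\<^esub>b\<in>B. (r \<otimes> coords R M B v b) \<odot>\<^bsub>M\<^esub> b)"
      by (rule M.finsum_cong') (use sub r v closed in \<open>auto simp: smult_assoc1 subset_iff\<close>)
    finally show "r \<odot>\<^bsub>M\<^esub> v = (\<Oplus>\<^bsub>M\<^esub>b\<in>B. (r \<otimes> coords R M B v b) \<odot>\<^bsub>M\<^esub> b)" .
  qed (use r v closed in auto)
qed auto

text \<open>Linear forms are determined by their values on a basis; equality as functions uses that
  members of \<open>dual_space\<close> are undefined outside the carrier.\<close>

lemma dual_space_eqI:
  assumes B: "is_basis R M B" and l: "l \<in> dual_space R M" and m: "m \<in> dual_space R M"
    and eq: "\<And>b. b \<in> B \<Longrightarrow> l b = m b"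
  shows "l = m"
proof
  fix v
  have sub: "B \<subseteq> carrier M"
    using B by (auto simp: is_basis_def)
  show "l v = m v"
  proof (cases "v \<in> carrier M")
    case True
    let ?c = "coords R M B v"
    have c: "?c \<in> B \<rightarrow> carrier R"
      using coords_PiE[OF B True] by auto
    have "l (\<Oplus>\<^bsub>M\<^esub>b\<in>B. ?c b \<odot>\<^bsub>M\<^esub> b) = (\<Oplus>b\<in>B. ?c b \<otimes> l b)"
      using sub by (intro dual_space_lincomb[OF l c]) auto
    also have "\<dots> = (\<Oplus>b\<in>B. ?c b \<otimes> m b)"
      using sub c by (intro R.finsum_cong') (auto simp: eq dual_spaceD[OF m] Pi_iff)
    also have "\<dots> = m (\<Oplus>\<^bsub>M\<^esub>b\<in>B. ?c b \<odot>\<^bsub>M\<^esub> b)"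
      using sub by (intro dual_space_lincomb[OF m c, symmetric]) auto
    finally show ?thesis
      using coords_expand[OF B True] by simp
  next
    case False
    then show ?thesis
      using PiE_arb[of l "carrier M" "\<lambda>_. carrier (regular_module R)" v]
        PiE_arb[of m "carrier M" "\<lambda>_. carrier (regular_module R)" v] l m
      by (simp add: dual_space_def linear_maps_def)
  qed
qed

lemma some_basis_is_basis: "free_of_finite_rank R M \<Longrightarrow> is_basis R M (some_basis R M)"
  unfolding free_of_finite_rank_def some_basis_def by (rule someI_ex)

text \<open>In coordinates the trace is \<open>\<Sum>\<^sub>b \<Sum>\<^sub>i l\<^sub>i(b) (v\<^sub>i)\<^sub>b\<close>.  Summing over \<open>b\<close> first collects the expansion of
  \<open>v\<^sub>i\<close> under \<open>l\<^sub>i\<close>.  The result no longer refers to the basis chosen in \<open>linear_trace\<close>.\<close>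

lemma linear_trace_sum_rank_one:
  assumes free: "free_of_finite_rank R M" and fin: "finite I"
    and l: "\<And>i. i \<in> I \<Longrightarrow> l i \<in> dual_space R M" and v: "\<And>i. i \<in> I \<Longrightarrow> v i \<in> carrier M"
    and \<alpha>: "\<And>u. u \<in> carrier M \<Longrightarrow> \<alpha> u = (\<Oplus>\<^bsub>M\<^esub>i\<in>I. l i u \<odot>\<^bsub>M\<^esub> v i)"
  shows "linear_trace R M \<alpha> = (\<Oplus>i\<in>I. l i (v i))"
proof -
  define B where "B = some_basis R M"
  have B: "is_basis R M B"
    unfolding B_def by (rule some_basis_is_basis[OF free])
  then have finB: "finite B" and sub: "B \<subseteq> carrier M"
    by (auto simp: is_basis_def)
  have closed: "coords R M B u b \<in> carrier R" if "u \<in> carrier M" "b \<in> B" for u b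
    using coords_PiE[OF B that(1)] that(2) by auto
  have l_closed: "l i u \<in> carrier R" if "i \<in> I" "u \<in> carrier M" for i u
    using dual_spaceD(1)[OF l] that .
  have 1: "coords R M B (\<alpha> b) b = (\<Oplus>i\<in>I. l i b \<otimes> coords R M B (v i) b)" if b: "b \<in> B" for b
  proof -
    let ?c = "\<lambda>v\<in>carrier M. coords R M B v b"
    have b': "b \<in> carrier M" using b sub by auto
    have "?c (\<alpha> b) = (\<Oplus>i\<in>I. l i b \<otimes> ?c (v i))"
      unfolding \<alpha>[OF b']
      by (rule dual_space_lincomb[OF coords_in_dual_space[OF B b]]) (use b' v l_closed in auto)
    also have "\<dots> = (\<Oplus>i\<in>I. l i b \<otimes> coords R M B (v i) b)"
      by (rule R.finsum_cong') (use b b' v l_closed closed in auto)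
    finally show ?thesis
      using b' v l_closed by (simp add: \<alpha> Pi_iff)
  qed
  have 2: "(\<Oplus>b\<in>B. l i b \<otimes> coords R M B (v i) b) = l i (v i)" if i: "i \<in> I" for i
  proof -
    have "(\<Oplus>b\<in>B. l i b \<otimes> coords R M B (v i) b) = (\<Oplus>b\<in>B. coords R M B (v i) b \<otimes> l i b)"
      by (rule R.finsum_cong') (use i v l_closed closed sub in \<open>auto simp: R.m_comm subset_iff\<close>)
    also have "\<dots> = l i (\<Oplus>\<^bsub>M\<^esub>b\<in>B. coords R M B (v i) b \<odot>\<^bsub>M\<^esub> b)"
      by (rule dual_space_lincomb[OF l, symmetric]) (use i v closed sub in auto)
    finally show ?thesis
      using coords_expand[OF B v] i by simp
  qed
  have "linear_trace R M \<alpha> = (\<Oplus>b\<in>B. \<Oplus>i\<in>I. l i b \<otimes> coords R M B (v i) b)"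
    unfolding linear_trace_def B_def[symmetric]
    by (rule R.finsum_cong')
      (use 1 v l_closed closed sub in \<open>auto intro!: R.finsum_closed simp: subset_iff\<close>)
  also have "\<dots> = (\<Oplus>i\<in>I. \<Oplus>b\<in>B. l i b \<otimes> coords R M B (v i) b)"
    by (rule R.finsum_swap[OF finB fin]) (use v l_closed closed sub in \<open>auto simp: subset_iff\<close>)
  also have "\<dots> = (\<Oplus>i\<in>I. l i (v i))"
    by (rule R.finsum_cong') (use 2 v l_closed in auto)
  finally show ?thesis .
qed

lemma linear_trace_finsum:
  assumes free: "free_of_finite_rank R M" and fin: "finite J"
    and \<beta>: "\<And>j u. \<lbrakk>j \<in> J; u \<in> carrier M\<rbrakk> \<Longrightarrow> \<beta> j u \<in> carrier M"
    and \<alpha>: "\<And>u. u \<in> carrier M \<Longrightarrow> \<alpha> u = (\<Oplus>\<^bsub>M\<^esub>j\<in>J. \<beta> j u)"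
  shows "linear_trace R M \<alpha> = (\<Oplus>j\<in>J. linear_trace R M (\<beta> j))"
proof -
  define B where "B = some_basis R M"
  have B: "is_basis R M B"
    unfolding B_def by (rule some_basis_is_basis[OF free])
  then have finB: "finite B" and sub: "B \<subseteq> carrier M"
    by (auto simp: is_basis_def)
  have closed: "coords R M B u b \<in> carrier R" if "u \<in> carrier M" "b \<in> B" for u b
    using coords_PiE[OF B that(1)] that(2) by auto
  have 1: "coords R M B (\<alpha> b) b = (\<Oplus>j\<in>J. coords R M B (\<beta> j b) b)" if b: "b \<in> B" for b
  proof -
    let ?c = "\<lambda>v\<in>carrier M. coords R M B v b"
    have b': "b \<in> carrier M" using b sub by auto
    have "?c (\<alpha> b) = (\<Oplus>j\<in>J. ?c (\<beta> j b))"
      unfolding \<alpha>[OF b']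
      by (rule dual_space_finsum[OF coords_in_dual_space[OF B b]]) (use b' \<beta> in auto)
    also have "\<dots> = (\<Oplus>j\<in>J. coords R M B (\<beta> j b) b)"
      by (rule R.finsum_cong') (use b b' \<beta> closed in auto)
    finally show ?thesis
      using b' \<beta> by (simp add: \<alpha> Pi_iff)
  qed
  have "linear_trace R M \<alpha> = (\<Oplus>b\<in>B. \<Oplus>j\<in>J. coords R M B (\<beta> j b) b)"
    unfolding linear_trace_def B_def[symmetric]
    by (rule R.finsum_cong')
      (use 1 \<beta> closed sub in \<open>auto intro!: R.finsum_closed simp: subset_iff\<close>)
  also have "\<dots> = (\<Oplus>j\<in>J. \<Oplus>b\<in>B. coords R M B (\<beta> j b) b)"
    by (rule R.finsum_swap[OF finB fin]) (use \<beta> closed sub in \<open>auto simp: subset_iff\<close>)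
  finally show ?thesis
    unfolding linear_trace_def B_def .
qed

lemma linear_trace_identity:
  assumes free: "free_of_finite_rank R M" and \<alpha>: "\<And>u. u \<in> carrier M \<Longrightarrow> \<alpha> u = u"
  shows "linear_trace R M \<alpha> = [rank R M] \<cdot> \<one>"
proof -
  have B: "is_basis R M (some_basis R M)"
    by (rule some_basis_is_basis[OF free])
  have "linear_trace R M \<alpha> = (\<Oplus>b\<in>some_basis R M. \<one>)"
    unfolding linear_trace_def
    by (rule R.finsum_cong')
      (use B coords_basis_element[OF B] in \<open>auto simp: \<alpha> is_basis_def subset_iff\<close>)
  also have "\<dots> = [rank R M] \<cdot> \<one>"
    unfolding rank_def by (rule R.add.finprod_const) simp
  finally show ?thesis .
qed

lemma rank_pos:
  assumes free: "free_of_finite_rank R M" and nz: "carrier M \<noteq> {\<zero>\<^bsub>M\<^esub>}"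
  shows "rank R M > 0"
proof (rule ccontr)
  assume "\<not> rank R M > 0"
  moreover have B: "is_basis R M (some_basis R M)"
    by (rule some_basis_is_basis[OF free])
  ultimately have "some_basis R M = {}"
    by (simp add: rank_def is_basis_def)
  then have "v = \<zero>\<^bsub>M\<^esub>" if "v \<in> carrier M" for v
    using coords_expand[OF B that] by simp
  then show False
    using nz by auto
qed

end

section \<open>The Casimir element of a symmetric algebra\<close>

text \<open>A balanced map is a group homomorphism out of \<open>A \<otimes>\<^sub>R A\<close>, presented by its values on pure tensors.
  It allows identities for the Casimir tensor \<open>\<Sum>\<^sub>x x \<otimes> x\<^sup>\<or>\<close> to be stated inside any target group
  without constructing the tensor product.\<close>

locale balanced_map = module R A + N: abelian_group N
  for R (structure) and A (structure) and N (structure) +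
  fixes F :: "'c \<Rightarrow> 'c \<Rightarrow> 'e"
  assumes F_closed: "\<lbrakk>a \<in> carrier A; b \<in> carrier A\<rbrakk> \<Longrightarrow> F a b \<in> carrier N"
    and F_add_left: "\<lbrakk>a \<in> carrier A; a' \<in> carrier A; b \<in> carrier A\<rbrakk> \<Longrightarrow>
      F (a \<oplus>\<^bsub>A\<^esub> a') b = F a b \<oplus>\<^bsub>N\<^esub> F a' b"
    and F_add_right: "\<lbrakk>a \<in> carrier A; b \<in> carrier A; b' \<in> carrier A\<rbrakk> \<Longrightarrow>
      F a (b \<oplus>\<^bsub>A\<^esub> b') = F a b \<oplus>\<^bsub>N\<^esub> F a b'"
    and F_balanced: "\<lbrakk>r \<in> carrier R; a \<in> carrier A; b \<in> carrier A\<rbrakk> \<Longrightarrow>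
      F (r \<odot>\<^bsub>A\<^esub> a) b = F a (r \<odot>\<^bsub>A\<^esub> b)"
begin

text \<open>The coefficient matrix may be moved across the tensor sign at the cost of a transposition.  Every
  identity for the Casimir tensor below is an instance, for a matrix of values of \<open>s\<close>.\<close>

lemma transpose_coefficients:
  assumes fin: "finite X" "finite Y" and c: "\<And>x y. \<lbrakk>x \<in> X; y \<in> Y\<rbrakk> \<Longrightarrow> c x y \<in> carrier R"
    and f: "\<And>y. y \<in> Y \<Longrightarrow> f y \<in> carrier A" and g: "\<And>x. x \<in> X \<Longrightarrow> g x \<in> carrier A"
  shows "(\<Oplus>\<^bsub>N\<^esub>x\<in>X. F (\<Oplus>\<^bsub>A\<^esub>y\<in>Y. c x y \<odot>\<^bsub>A\<^esub> f y) (g x)) =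
    (\<Oplus>\<^bsub>N\<^esub>y\<in>Y. F (f y) (\<Oplus>\<^bsub>A\<^esub>x\<in>X. c x y \<odot>\<^bsub>A\<^esub> g x))"
proof -
  have left: "F (\<Oplus>\<^bsub>A\<^esub>y\<in>Y. c x y \<odot>\<^bsub>A\<^esub> f y) (g x) = (\<Oplus>\<^bsub>N\<^esub>y\<in>Y. F (f y) (c x y \<odot>\<^bsub>A\<^esub> g x))"
    if x: "x \<in> X" for x
  proof -
    have "F (\<Oplus>\<^bsub>A\<^esub>y\<in>Y. c x y \<odot>\<^bsub>A\<^esub> f y) (g x) = (\<Oplus>\<^bsub>N\<^esub>y\<in>Y. F (c x y \<odot>\<^bsub>A\<^esub> f y) (g x))"
      by (rule additive_finsum[OF M.abelian_group_axioms N.abelian_group_axioms,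
          where f = "\<lambda>a. F a (g x)"])
        (use x c f g in \<open>auto simp: F_closed F_add_left\<close>)
    also have "\<dots> = (\<Oplus>\<^bsub>N\<^esub>y\<in>Y. F (f y) (c x y \<odot>\<^bsub>A\<^esub> g x))"
      by (rule N.finsum_cong') (use x c f g in \<open>auto simp: F_closed F_balanced\<close>)
    finally show ?thesis .
  qed
  have right: "F (f y) (\<Oplus>\<^bsub>A\<^esub>x\<in>X. c x y \<odot>\<^bsub>A\<^esub> g x) = (\<Oplus>\<^bsub>N\<^esub>x\<in>X. F (f y) (c x y \<odot>\<^bsub>A\<^esub> g x))"
    if y: "y \<in> Y" for y
    by (rule additive_finsum[OF M.abelian_group_axioms N.abelian_group_axioms])
      (use y c f g in \<open>auto simp: F_closed F_add_right\<close>)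
  have "(\<Oplus>\<^bsub>N\<^esub>x\<in>X. F (\<Oplus>\<^bsub>A\<^esub>y\<in>Y. c x y \<odot>\<^bsub>A\<^esub> f y) (g x)) =
    (\<Oplus>\<^bsub>N\<^esub>x\<in>X. \<Oplus>\<^bsub>N\<^esub>y\<in>Y. F (f y) (c x y \<odot>\<^bsub>A\<^esub> g x))"
    by (rule N.finsum_cong')
      (use left c f g in \<open>auto intro!: N.finsum_closed simp: F_closed\<close>)
  also have "\<dots> = (\<Oplus>\<^bsub>N\<^esub>y\<in>Y. \<Oplus>\<^bsub>N\<^esub>x\<in>X. F (f y) (c x y \<odot>\<^bsub>A\<^esub> g x))"
    by (rule N.finsum_swap[OF fin]) (use c f g in \<open>auto simp: F_closed\<close>)
  also have "\<dots> = (\<Oplus>\<^bsub>N\<^esub>y\<in>Y. F (f y) (\<Oplus>\<^bsub>A\<^esub>x\<in>X. c x y \<odot>\<^bsub>A\<^esub> g x))"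
    by (rule N.finsum_cong') (use right c f g in \<open>auto intro!: F_closed M.finsum_closed\<close>)
  finally show ?thesis .
qed

end

locale symmetrised_algebra = R: cring R + A: ring A + assoc_algebra R A
  for R :: "('o, 'm) ring_scheme" (structure)
    and A :: "('o, 'a, 'n) module_scheme" (structure) +
  fixes s X d
  assumes form: "symmetrising_form R A s"
    and basis: "is_basis R A X"
    and dual_basis: "is_dual_basis R A s X d"
begin

lemma X_finite: "finite X" and X_carrier: "x \<in> X \<Longrightarrow> x \<in> carrier A"
  using basis by (auto simp: is_basis_def)

lemma d_carrier: "x \<in> X \<Longrightarrow> d x \<in> carrier A"
  using dual_basis by (auto simp: is_dual_basis_def)

lemma form_dual_basis: "\<lbrakk>x \<in> X; y \<in> X\<rbrakk> \<Longrightarrow> s (x \<otimes>\<^bsub>A\<^esub> d y) = (if x = y then \<one> else \<zero>)"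
  using dual_basis by (auto simp: is_dual_basis_def)

text \<open>A bimodule isomorphism \<open>\<Phi>\<close> with \<open>\<Phi>(1) = s\<close> sends \<open>a\<close> both to \<open>x \<mapsto> s(x a)\<close> (as \<open>a = a \<cdot> 1\<close>) and to
  \<open>x \<mapsto> s(a x)\<close> (as \<open>a = 1 \<cdot> a\<close>).  Comparing the two gives symmetry; injectivity of \<open>\<Phi>\<close> gives
  faithfulness.\<close>

lemma form_properties:
  shows form_in_dual_space: "s \<in> dual_space R A"
    and form_symmetric: "\<lbrakk>a \<in> carrier A; b \<in> carrier A\<rbrakk> \<Longrightarrow> s (a \<otimes>\<^bsub>A\<^esub> b) = s (b \<otimes>\<^bsub>A\<^esub> a)"
    and form_faithful: "\<lbrakk>a \<in> carrier A; b \<in> carrier A;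
      \<And>x. x \<in> carrier A \<Longrightarrow> s (x \<otimes>\<^bsub>A\<^esub> a) = s (x \<otimes>\<^bsub>A\<^esub> b)\<rbrakk> \<Longrightarrow> a = b"
proof -
  obtain \<Phi> where iso: "dual_bimodule_iso R A \<Phi>" and s: "s = \<Phi> \<one>\<^bsub>A\<^esub>"
    using form by (auto simp: symmetrising_form_def)
  have dual: "\<Phi> a \<in> dual_space R A" if "a \<in> carrier A" for a
    using iso that bij_betwE unfolding dual_bimodule_iso_def by blast
  show "s \<in> dual_space R A"
    unfolding s by (rule dual) simp
  have left: "\<Phi> a x = s (x \<otimes>\<^bsub>A\<^esub> a)" if "a \<in> carrier A" "x \<in> carrier A" for a x
  proof -
    have "\<Phi> (a \<otimes>\<^bsub>A\<^esub> \<one>\<^bsub>A\<^esub>) x = \<Phi> \<one>\<^bsub>A\<^esub> (x \<otimes>\<^bsub>A\<^esub> a)"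
      using iso that unfolding dual_bimodule_iso_def by blast
    then show ?thesis using that by (simp add: s)
  qed
  have right: "\<Phi> a x = s (a \<otimes>\<^bsub>A\<^esub> x)" if "a \<in> carrier A" "x \<in> carrier A" for a x
  proof -
    have "\<Phi> (\<one>\<^bsub>A\<^esub> \<otimes>\<^bsub>A\<^esub> a) x = \<Phi> \<one>\<^bsub>A\<^esub> (a \<otimes>\<^bsub>A\<^esub> x)"
      using iso that unfolding dual_bimodule_iso_def by blast
    then show ?thesis using that by (simp add: s)
  qed
  show "s (a \<otimes>\<^bsub>A\<^esub> b) = s (b \<otimes>\<^bsub>A\<^esub> a)" if "a \<in> carrier A" "b \<in> carrier A" for a b
    using left[OF that] right[OF that] by simp
  show "a = b" if a: "a \<in> carrier A" and b: "b \<in> carrier A"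
    and eq: "\<And>x. x \<in> carrier A \<Longrightarrow> s (x \<otimes>\<^bsub>A\<^esub> a) = s (x \<otimes>\<^bsub>A\<^esub> b)" for a b
  proof -
    have "\<Phi> a = \<Phi> b"
    proof (rule dual_space_eqI[OF basis dual[OF a] dual[OF b]])
      fix x assume "x \<in> X"
      then show "\<Phi> a x = \<Phi> b x"
        using left a b eq X_carrier by simp
    qed
    then show ?thesis
      using iso a b unfolding dual_bimodule_iso_def bij_betw_def by (blast dest: inj_onD)
  qed
qed

lemmas form_simps = dual_spaceD[OF form_in_dual_space]

lemma form_translate_dual:
  assumes "a \<in> carrier A"
  shows "(\<lambda>x\<in>carrier A. s (x \<otimes>\<^bsub>A\<^esub> a)) \<in> dual_space R A"
  by (rule dual_spaceI)
    (use assms in \<open>simp_all add: form_simps A.l_distr smult_mult_left\<close>)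

lemma basis_expansion:
  assumes v: "v \<in> carrier A"
  shows "(\<Oplus>\<^bsub>A\<^esub>x\<in>X. s (v \<otimes>\<^bsub>A\<^esub> d x) \<odot>\<^bsub>A\<^esub> x) = v"
proof -
  let ?c = "coords R A X v"
  have c: "?c x \<in> carrier R" if "x \<in> X" for x
    using coords_PiE[OF basis v] that by auto
  have coeff: "s (v \<otimes>\<^bsub>A\<^esub> d y) = ?c y" if y: "y \<in> X" for y
  proof -
    let ?l = "\<lambda>x\<in>carrier A. s (x \<otimes>\<^bsub>A\<^esub> d y)"
    have "?l (\<Oplus>\<^bsub>A\<^esub>x\<in>X. ?c x \<odot>\<^bsub>A\<^esub> x) = (\<Oplus>x\<in>X. ?c x \<otimes> ?l x)"
      by (rule dual_space_lincomb[OF form_translate_dual[OF d_carrier[OF y]]])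
        (use c X_carrier in auto)
    also have "\<dots> = (\<Oplus>x\<in>X. if y = x then ?c x else \<zero>)"
      by (rule R.finsum_cong') (use c y X_carrier form_dual_basis in auto)
    also have "\<dots> = ?c y"
      by (rule R.finsum_singleton[OF y X_finite]) (use c in auto)
    finally show ?thesis
      using v by (simp add: coords_expand[OF basis v])
  qed
  have "(\<Oplus>\<^bsub>A\<^esub>x\<in>X. s (v \<otimes>\<^bsub>A\<^esub> d x) \<odot>\<^bsub>A\<^esub> x) = (\<Oplus>\<^bsub>A\<^esub>x\<in>X. ?c x \<odot>\<^bsub>A\<^esub> x)"
    by (rule A.finsum_cong') (use coeff c X_carrier in auto)
  also have "\<dots> = v"
    by (rule coords_expand[OF basis v])
  finally show ?thesis .
qed

text \<open>Only \<open>X\<close> is given as a basis, so spanning by the dual basis has to come from faithfulness of \<open>s\<close>: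
  both sides pair equally with each element of \<open>X\<close>.\<close>

lemma dual_basis_expansion:
  assumes v: "v \<in> carrier A"
  shows "(\<Oplus>\<^bsub>A\<^esub>x\<in>X. s (v \<otimes>\<^bsub>A\<^esub> x) \<odot>\<^bsub>A\<^esub> d x) = v"
proof -
  define w where "w = (\<Oplus>\<^bsub>A\<^esub>x\<in>X. s (v \<otimes>\<^bsub>A\<^esub> x) \<odot>\<^bsub>A\<^esub> d x)"
  have s_closed: "s (v \<otimes>\<^bsub>A\<^esub> x) \<in> carrier R" if "x \<in> X" for x
    using v that X_carrier by (simp add: form_simps)
  have w: "w \<in> carrier A"
    unfolding w_def using s_closed d_carrier by (intro A.finsum_closed) auto
  have on_basis: "s (y \<otimes>\<^bsub>A\<^esub> w) = s (y \<otimes>\<^bsub>A\<^esub> v)" if y: "y \<in> X" for y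
  proof -
    have y': "y \<in> carrier A" by (rule X_carrier[OF y])
    have "y \<otimes>\<^bsub>A\<^esub> w = (\<Oplus>\<^bsub>A\<^esub>x\<in>X. y \<otimes>\<^bsub>A\<^esub> (s (v \<otimes>\<^bsub>A\<^esub> x) \<odot>\<^bsub>A\<^esub> d x))"
      unfolding w_def
      by (rule A.finsum_rdistr[OF X_finite y']) (use s_closed d_carrier in auto)
    also have "\<dots> = (\<Oplus>\<^bsub>A\<^esub>x\<in>X. s (v \<otimes>\<^bsub>A\<^esub> x) \<odot>\<^bsub>A\<^esub> (y \<otimes>\<^bsub>A\<^esub> d x))"
      by (rule A.finsum_cong') (use s_closed d_carrier y' in \<open>auto simp: smult_mult_right\<close>)
    finally have "s (y \<otimes>\<^bsub>A\<^esub> w) = s (\<Oplus>\<^bsub>A\<^esub>x\<in>X. s (v \<otimes>\<^bsub>A\<^esub> x) \<odot>\<^bsub>A\<^esub> (y \<otimes>\<^bsub>A\<^esub> d x))"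
      by simp
    also have "\<dots> = (\<Oplus>x\<in>X. s (v \<otimes>\<^bsub>A\<^esub> x) \<otimes> s (y \<otimes>\<^bsub>A\<^esub> d x))"
      by (rule dual_space_lincomb[OF form_in_dual_space]) (use s_closed d_carrier y' in auto)
    also have "\<dots> = (\<Oplus>x\<in>X. if y = x then s (v \<otimes>\<^bsub>A\<^esub> x) else \<zero>)"
      by (rule R.finsum_cong') (use s_closed y form_dual_basis in auto)
    also have "\<dots> = s (v \<otimes>\<^bsub>A\<^esub> y)"
      by (rule R.finsum_singleton[OF y X_finite]) (use s_closed in auto)
    also have "\<dots> = s (y \<otimes>\<^bsub>A\<^esub> v)"
      by (rule form_symmetric[OF v y'])
    finally show ?thesis .
  qed
  have eq: "(\<lambda>x\<in>carrier A. s (x \<otimes>\<^bsub>A\<^esub> w)) = (\<lambda>x\<in>carrier A. s (x \<otimes>\<^bsub>A\<^esub> v))"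
    by (rule dual_space_eqI[OF basis form_translate_dual[OF w] form_translate_dual[OF v]])
      (simp add: X_carrier on_basis)
  have "s (x \<otimes>\<^bsub>A\<^esub> w) = s (x \<otimes>\<^bsub>A\<^esub> v)" if "x \<in> carrier A" for x
    using fun_cong[OF eq, of x] that by simp
  then show ?thesis
    unfolding w_def[symmetric] by (rule form_faithful[OF w v])
qed

text \<open>The Casimir tensor satisfies \<open>\<Sum>\<^sub>x a x \<otimes> x\<^sup>\<or> = \<Sum>\<^sub>x x \<otimes> x\<^sup>\<or> a\<close>: with respect to the two bases, left
  multiplication on \<open>X\<close> and right multiplication on \<open>X\<^sup>\<or>\<close> have transposed matrices, since
  \<open>s(a x y\<^sup>\<or>) = s(y\<^sup>\<or> a x)\<close>.\<close>

lemma balanced_casimir_shift: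
  assumes F: "balanced_map R A N F" and a: "a \<in> carrier A"
  shows "(\<Oplus>\<^bsub>N\<^esub>x\<in>X. F (a \<otimes>\<^bsub>A\<^esub> x) (d x)) = (\<Oplus>\<^bsub>N\<^esub>x\<in>X. F x (d x \<otimes>\<^bsub>A\<^esub> a))"
proof -
  interpret F: balanced_map R A N F by (rule F)
  let ?c = "\<lambda>x y. s (a \<otimes>\<^bsub>A\<^esub> x \<otimes>\<^bsub>A\<^esub> d y)"
  have c: "?c x y \<in> carrier R" if "x \<in> X" "y \<in> X" for x y
    using that a X_carrier d_carrier by (simp add: form_simps)
  have c': "?c x y = s ((d y \<otimes>\<^bsub>A\<^esub> a) \<otimes>\<^bsub>A\<^esub> x)" if "x \<in> X" "y \<in> X" for x y
    using that a X_carrier d_carrier form_symmetric[of "a \<otimes>\<^bsub>A\<^esub> x" "d y"]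
    by (simp add: A.m_assoc)
  have "(\<Oplus>\<^bsub>N\<^esub>x\<in>X. F (a \<otimes>\<^bsub>A\<^esub> x) (d x)) = (\<Oplus>\<^bsub>N\<^esub>x\<in>X. F (\<Oplus>\<^bsub>A\<^esub>y\<in>X. ?c x y \<odot>\<^bsub>A\<^esub> y) (d x))"
    by (rule F.N.finsum_cong')
      (use a X_carrier d_carrier in \<open>auto simp: basis_expansion F.F_closed\<close>)
  also have "\<dots> = (\<Oplus>\<^bsub>N\<^esub>y\<in>X. F y (\<Oplus>\<^bsub>A\<^esub>x\<in>X. ?c x y \<odot>\<^bsub>A\<^esub> d x))"
    by (rule F.transpose_coefficients[OF X_finite X_finite]) (use c X_carrier d_carrier in auto)
  also have "\<dots> = (\<Oplus>\<^bsub>N\<^esub>y\<in>X. F y (d y \<otimes>\<^bsub>A\<^esub> a))"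
  proof (rule F.N.finsum_cong')
    fix y assume y: "y \<in> X"
    have "(\<Oplus>\<^bsub>A\<^esub>x\<in>X. ?c x y \<odot>\<^bsub>A\<^esub> d x) = (\<Oplus>\<^bsub>A\<^esub>x\<in>X. s ((d y \<otimes>\<^bsub>A\<^esub> a) \<otimes>\<^bsub>A\<^esub> x) \<odot>\<^bsub>A\<^esub> d x)"
      by (rule A.finsum_cong') (use y a c c' X_carrier d_carrier in \<open>auto simp: form_simps\<close>)
    also have "\<dots> = d y \<otimes>\<^bsub>A\<^esub> a"
      by (rule dual_basis_expansion) (use y a d_carrier in simp)
    finally show "F y (\<Oplus>\<^bsub>A\<^esub>x\<in>X. ?c x y \<odot>\<^bsub>A\<^esub> d x) = F y (d y \<otimes>\<^bsub>A\<^esub> a)"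
      by simp
  qed (use a X_carrier d_carrier in \<open>auto simp: F.F_closed\<close>)
  finally show ?thesis .
qed

text \<open>The matrix \<open>s(x\<^sup>\<or> y\<^sup>\<or>)\<close> that expresses \<open>X\<^sup>\<or>\<close> in terms of \<open>X\<close> is symmetric.\<close>

lemma casimir_flip: "(\<Oplus>\<^bsub>A\<^esub>x\<in>X. d x \<otimes>\<^bsub>A\<^esub> x) = (\<Oplus>\<^bsub>A\<^esub>x\<in>X. x \<otimes>\<^bsub>A\<^esub> d x)"
proof -
  interpret F: balanced_map R A A "\<lambda>a b. a \<otimes>\<^bsub>A\<^esub> b"
    by unfold_locales
      (simp_all add: A.l_distr A.r_distr smult_mult_left smult_mult_right)
  let ?c = "\<lambda>x y. s (d x \<otimes>\<^bsub>A\<^esub> d y)"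
  have c: "?c x y \<in> carrier R" if "x \<in> X" "y \<in> X" for x y
    using that d_carrier by (simp add: form_simps)
  have "(\<Oplus>\<^bsub>A\<^esub>x\<in>X. d x \<otimes>\<^bsub>A\<^esub> x) = (\<Oplus>\<^bsub>A\<^esub>x\<in>X. (\<Oplus>\<^bsub>A\<^esub>y\<in>X. ?c x y \<odot>\<^bsub>A\<^esub> y) \<otimes>\<^bsub>A\<^esub> x)"
    by (rule A.finsum_cong') (use X_carrier d_carrier in \<open>auto simp: basis_expansion\<close>)
  also have "\<dots> = (\<Oplus>\<^bsub>A\<^esub>y\<in>X. y \<otimes>\<^bsub>A\<^esub> (\<Oplus>\<^bsub>A\<^esub>x\<in>X. ?c x y \<odot>\<^bsub>A\<^esub> x))"
    by (rule F.transpose_coefficients[OF X_finite X_finite]) (use c X_carrier in auto)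
  also have "\<dots> = (\<Oplus>\<^bsub>A\<^esub>y\<in>X. y \<otimes>\<^bsub>A\<^esub> d y)"
  proof (rule A.finsum_cong')
    fix y assume y: "y \<in> X"
    have "(\<Oplus>\<^bsub>A\<^esub>x\<in>X. ?c x y \<odot>\<^bsub>A\<^esub> x) = (\<Oplus>\<^bsub>A\<^esub>x\<in>X. s (d y \<otimes>\<^bsub>A\<^esub> d x) \<odot>\<^bsub>A\<^esub> x)"
      by (rule A.finsum_cong')
        (use y c X_carrier d_carrier form_symmetric[OF d_carrier d_carrier] in auto)
    also have "\<dots> = d y"
      by (rule basis_expansion) (use y d_carrier in simp)
    finally show "y \<otimes>\<^bsub>A\<^esub> (\<Oplus>\<^bsub>A\<^esub>x\<in>X. ?c x y \<odot>\<^bsub>A\<^esub> x) = y \<otimes>\<^bsub>A\<^esub> d y"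
      by simp
  qed (use X_carrier d_carrier in auto)
  finally show ?thesis .
qed

end

section \<open>Relative traces on lattices\<close>

locale algebra_module = R: cring R + A: ring A + assoc_algebra R A + U: left_module A U
  for R :: "('o, 'm) ring_scheme" (structure)
    and A :: "('o, 'a, 'n) module_scheme" (structure)
    and U :: "('a, 'u, 'l) module_scheme" (structure)
begin

abbreviation V where "V \<equiv> restrict_scalars A U"

lemma V_simps [simp]:
  "carrier V = carrier U" "\<zero>\<^bsub>V\<^esub> = \<zero>\<^bsub>U\<^esub>" "x \<oplus>\<^bsub>V\<^esub> y = x \<oplus>\<^bsub>U\<^esub> y"
  by (simp_all add: restrict_scalars_def)

lemma V_smult: "r \<odot>\<^bsub>V\<^esub> x = (r \<odot>\<^bsub>A\<^esub> \<one>\<^bsub>A\<^esub>) \<odot>\<^bsub>U\<^esub> x"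
  by (simp add: restrict_scalars_def)

lemma smult_as_mult:
  assumes "r \<in> carrier R" and "a \<in> carrier A"
  shows "(r \<odot>\<^bsub>A\<^esub> \<one>\<^bsub>A\<^esub>) \<otimes>\<^bsub>A\<^esub> a = r \<odot>\<^bsub>A\<^esub> a" and "a \<otimes>\<^bsub>A\<^esub> (r \<odot>\<^bsub>A\<^esub> \<one>\<^bsub>A\<^esub>) = r \<odot>\<^bsub>A\<^esub> a"
  using assms by (simp_all add: smult_mult_left smult_mult_right)

lemma smult_act:
  assumes "r \<in> carrier R" and "a \<in> carrier A" and "u \<in> carrier U"
  shows "(r \<odot>\<^bsub>A\<^esub> a) \<odot>\<^bsub>U\<^esub> u = r \<odot>\<^bsub>V\<^esub> (a \<odot>\<^bsub>U\<^esub> u)"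
    and "a \<odot>\<^bsub>U\<^esub> (r \<odot>\<^bsub>V\<^esub> u) = r \<odot>\<^bsub>V\<^esub> (a \<odot>\<^bsub>U\<^esub> u)"
  using assms by (simp_all add: V_smult U.smult_assoc1[symmetric] smult_as_mult)

text \<open>The zero and the addition of \<open>V\<close> are those of \<open>U\<close>, but the two records have different types of
  scalars, so finite sums in \<open>U\<close> and in \<open>V\<close> are different terms.  The sums below are taken
  in \<open>V\<close>, where coordinates and traces live.\<close>

lemma module_V: "module R V"
proof (rule moduleI)
  show "abelian_group V"
  proof (rule abelian_groupI)
    show "\<exists>y\<in>carrier V. y \<oplus>\<^bsub>V\<^esub> x = \<zero>\<^bsub>V\<^esub>" if "x \<in> carrier V" for x
      using that by (intro bexI[of _ "\<ominus>\<^bsub>U\<^esub> x"]) (simp_all add: U.M.l_neg)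
  qed (simp_all add: U.M.a_assoc U.M.a_comm U.M.a_lcomm)
qed (simp_all add: V_smult R.cring_axioms smult_l_distr U.smult_l_distr U.smult_r_distr
    smult_assoc1 U.smult_assoc1[symmetric] smult_mult_left)

sublocale V: module R V
  by (rule module_V)

lemma V_smult_closed [simp]:
  "\<lbrakk>r \<in> carrier R; u \<in> carrier U\<rbrakk> \<Longrightarrow> r \<odot>\<^bsub>V\<^esub> u \<in> carrier U"
  using V.smult_closed by simp

lemma act_finsum:
  assumes "a \<in> carrier A" and "v \<in> I \<rightarrow> carrier U"
  shows "a \<odot>\<^bsub>U\<^esub> (\<Oplus>\<^bsub>V\<^esub>i\<in>I. v i) = (\<Oplus>\<^bsub>V\<^esub>i\<in>I. a \<odot>\<^bsub>U\<^esub> v i)"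
  by (rule additive_finsum[OF V.M.abelian_group_axioms V.M.abelian_group_axioms])
    (use assms in \<open>auto simp: U.smult_r_distr\<close>)

lemma finsum_act:
  assumes "u \<in> carrier U" and "a \<in> I \<rightarrow> carrier A"
  shows "(\<Oplus>\<^bsub>A\<^esub>i\<in>I. a i) \<odot>\<^bsub>U\<^esub> u = (\<Oplus>\<^bsub>V\<^esub>i\<in>I. a i \<odot>\<^bsub>U\<^esub> u)"
  by (rule additive_finsum[OF A.abelian_group_axioms V.M.abelian_group_axioms,
      where f = "\<lambda>a. a \<odot>\<^bsub>U\<^esub> u"])
    (use assms in \<open>auto simp: U.smult_l_distr\<close>)

end

locale symmetrised_algebra_module = symmetrised_algebra R A s X d + algebra_module R A U
  for R :: "('o, 'm) ring_scheme" (structure)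
    and A :: "('o, 'a, 'n) module_scheme" (structure)
    and s X d
    and U :: "('a, 'u, 'l) module_scheme" (structure)
begin

text \<open>This is the relative trace \<open>\<Sum>\<^sub>x x \<circ> \<beta> \<circ> x\<^sup>\<or>\<close> of the rank one endomorphism \<open>\<beta> = (u \<mapsto> l(u) b)\<close>; since rank
  one endomorphisms span \<open>End\<^sub>R(U)\<close>, it suffices to treat these.\<close>

definition relative_trace :: "('u \<Rightarrow> 'o) \<Rightarrow> 'u \<Rightarrow> 'u \<Rightarrow> 'u" where
  "relative_trace l b u = (\<Oplus>\<^bsub>V\<^esub>x\<in>X. l (d x \<odot>\<^bsub>U\<^esub> u) \<odot>\<^bsub>V\<^esub> (x \<odot>\<^bsub>U\<^esub> b))"

context
  fixes l b
  assumes l: "l \<in> dual_space R V" and b: "b \<in> carrier U"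
begin

lemma functional_simps:
  "u \<in> carrier U \<Longrightarrow> l u \<in> carrier R"
  "\<lbrakk>u \<in> carrier U; w \<in> carrier U\<rbrakk> \<Longrightarrow> l (u \<oplus>\<^bsub>U\<^esub> w) = l u \<oplus> l w"
  "\<lbrakk>r \<in> carrier R; u \<in> carrier U\<rbrakk> \<Longrightarrow> l (r \<odot>\<^bsub>V\<^esub> u) = r \<otimes> l u"
  using dual_spaceD[OF l] by simp_all

lemma relative_trace_closed:
  "u \<in> carrier U \<Longrightarrow> relative_trace l b u \<in> carrier U"
  unfolding relative_trace_def
  using V.M.finsum_closed[of "\<lambda>x. l (d x \<odot>\<^bsub>U\<^esub> u) \<odot>\<^bsub>V\<^esub> (x \<odot>\<^bsub>U\<^esub> b)" X] b X_carrier d_carrier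
  by (simp add: Pi_iff functional_simps)

lemma relative_trace_add:
  assumes u: "u \<in> carrier U" and w: "w \<in> carrier U"
  shows "relative_trace l b (u \<oplus>\<^bsub>U\<^esub> w) = relative_trace l b u \<oplus>\<^bsub>U\<^esub> relative_trace l b w"
proof -
  have "relative_trace l b (u \<oplus>\<^bsub>U\<^esub> w) = (\<Oplus>\<^bsub>V\<^esub>x\<in>X. l (d x \<odot>\<^bsub>U\<^esub> u) \<odot>\<^bsub>V\<^esub> (x \<odot>\<^bsub>U\<^esub> b)
      \<oplus>\<^bsub>V\<^esub> l (d x \<odot>\<^bsub>U\<^esub> w) \<odot>\<^bsub>V\<^esub> (x \<odot>\<^bsub>U\<^esub> b))"
    unfolding relative_trace_def
    by (rule V.M.finsum_cong')
      (use u w b X_carrier d_carrier in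
        \<open>auto simp: U.smult_r_distr functional_simps V.smult_l_distr[simplified]\<close>)
  also have "\<dots> = relative_trace l b u \<oplus>\<^bsub>V\<^esub> relative_trace l b w"
    unfolding relative_trace_def
    by (rule V.M.finsum_addf) (use u w b X_carrier d_carrier in \<open>auto simp: functional_simps\<close>)
  finally show ?thesis
    by simp
qed

text \<open>For fixed \<open>u\<close>, the value is the image of the Casimir tensor under the balanced map
  \<open>(x, y) \<mapsto> l(y u) x b\<close>, so \<open>a\<close> can be moved from the second tensor factor to the first.\<close>

lemma relative_trace_commutes:
  assumes a: "a \<in> carrier A" and u: "u \<in> carrier U"
  shows "relative_trace l b (a \<odot>\<^bsub>U\<^esub> u) = a \<odot>\<^bsub>U\<^esub> relative_trace l b u"
proof -
  let ?F = "\<lambda>x y. l (y \<odot>\<^bsub>U\<^esub> u) \<odot>\<^bsub>V\<^esub> (x \<odot>\<^bsub>U\<^esub> b)"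
  have F: "balanced_map R A V ?F"
  proof unfold_locales
    show "?F (r \<odot>\<^bsub>A\<^esub> x) y = ?F x (r \<odot>\<^bsub>A\<^esub> y)"
      if "r \<in> carrier R" "x \<in> carrier A" "y \<in> carrier A" for r x y
    proof -
      have "?F (r \<odot>\<^bsub>A\<^esub> x) y = (l (y \<odot>\<^bsub>U\<^esub> u) \<otimes> r) \<odot>\<^bsub>V\<^esub> (x \<odot>\<^bsub>U\<^esub> b)"
        using that u b by (simp add: smult_act V.smult_assoc1[simplified] functional_simps)
      also have "l (y \<odot>\<^bsub>U\<^esub> u) \<otimes> r = l ((r \<odot>\<^bsub>A\<^esub> y) \<odot>\<^bsub>U\<^esub> u)"
        using that u by (simp add: smult_act functional_simps R.m_comm)
      finally show ?thesis .
    qed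
  qed (use u b in \<open>simp_all add: functional_simps U.smult_l_distr U.smult_r_distr V.smult_l_distr[simplified] V.smult_r_distr[simplified]\<close>)
  have "relative_trace l b (a \<odot>\<^bsub>U\<^esub> u) = (\<Oplus>\<^bsub>V\<^esub>x\<in>X. ?F x (d x \<otimes>\<^bsub>A\<^esub> a))"
    unfolding relative_trace_def
    by (rule V.M.finsum_cong')
      (use a u b X_carrier d_carrier in \<open>auto simp: U.smult_assoc1 functional_simps\<close>)
  also have "\<dots> = (\<Oplus>\<^bsub>V\<^esub>x\<in>X. ?F (a \<otimes>\<^bsub>A\<^esub> x) (d x))"
    by (rule balanced_casimir_shift[OF F a, symmetric])
  also have "\<dots> = (\<Oplus>\<^bsub>V\<^esub>x\<in>X. a \<odot>\<^bsub>U\<^esub> (?F x (d x)))"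
    by (rule V.M.finsum_cong')
      (use a u b X_carrier d_carrier in
        \<open>auto simp: U.smult_assoc1 smult_act functional_simps\<close>)
  also have "\<dots> = a \<odot>\<^bsub>U\<^esub> relative_trace l b u"
    unfolding relative_trace_def
    by (rule act_finsum[symmetric]) (use a u b X_carrier d_carrier in \<open>auto simp: functional_simps\<close>)
  finally show ?thesis .
qed

lemma relative_trace_linear: "restrict (relative_trace l b) (carrier U) \<in> linear_maps A U U"
  by (auto simp: linear_maps_def relative_trace_closed relative_trace_add relative_trace_commutes)

text \<open>The \<open>x\<close>-th summand is the rank one map given by the form \<open>u \<mapsto> l(x\<^sup>\<or> u)\<close> and the vector \<open>x b\<close>; it
  contributes \<open>l(x\<^sup>\<or> x b)\<close>.  The sum of the \<open>x\<^sup>\<or> x\<close> is then replaced by that of the \<open>x x\<^sup>\<or>\<close>.\<close>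

lemma linear_trace_relative_trace:
  assumes free: "free_of_finite_rank R V"
    and T: "\<And>u. u \<in> carrier U \<Longrightarrow> T u = relative_trace l b u"
  shows "linear_trace R V T = l ((\<Oplus>\<^bsub>A\<^esub>x\<in>X. x \<otimes>\<^bsub>A\<^esub> d x) \<odot>\<^bsub>U\<^esub> b)"
proof -
  have "linear_trace R V T = (\<Oplus>x\<in>X. restrict (\<lambda>u. l (d x \<odot>\<^bsub>U\<^esub> u)) (carrier V) (x \<odot>\<^bsub>U\<^esub> b))"
  proof (rule V.linear_trace_sum_rank_one[OF free X_finite])
    show "restrict (\<lambda>u. l (d x \<odot>\<^bsub>U\<^esub> u)) (carrier V) \<in> dual_space R V" if x: "x \<in> X" for x
      by (rule dual_spaceI)
        (use d_carrier[OF x] in \<open>simp_all add: functional_simps U.smult_r_distr smult_act\<close>)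
    show "x \<odot>\<^bsub>U\<^esub> b \<in> carrier V" if "x \<in> X" for x
      using X_carrier[OF that] b by simp
    show "T u = (\<Oplus>\<^bsub>V\<^esub>x\<in>X. restrict (\<lambda>u. l (d x \<odot>\<^bsub>U\<^esub> u)) (carrier V) u \<odot>\<^bsub>V\<^esub> (x \<odot>\<^bsub>U\<^esub> b))"
      if "u \<in> carrier V" for u
      using that by (simp add: T relative_trace_def)
  qed
  also have "\<dots> = (\<Oplus>x\<in>X. l ((d x \<otimes>\<^bsub>A\<^esub> x) \<odot>\<^bsub>U\<^esub> b))"
    by (rule R.finsum_cong')
      (use b X_carrier d_carrier in \<open>auto simp: U.smult_assoc1 functional_simps\<close>)
  also have "\<dots> = l (\<Oplus>\<^bsub>V\<^esub>x\<in>X. (d x \<otimes>\<^bsub>A\<^esub> x) \<odot>\<^bsub>U\<^esub> b)"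
    by (rule V.dual_space_finsum[OF l, symmetric]) (use b X_carrier d_carrier in auto)
  also have "(\<Oplus>\<^bsub>V\<^esub>x\<in>X. (d x \<otimes>\<^bsub>A\<^esub> x) \<odot>\<^bsub>U\<^esub> b) = (\<Oplus>\<^bsub>A\<^esub>x\<in>X. d x \<otimes>\<^bsub>A\<^esub> x) \<odot>\<^bsub>U\<^esub> b"
    by (rule finsum_act[symmetric]) (use b X_carrier d_carrier in auto)
  finally show ?thesis
    by (simp add: casimir_flip)
qed

end

lemma form_comp_in_dual_space:
  assumes \<phi>: "\<phi> \<in> linear_maps A U (regular_module A)"
  shows "(\<lambda>u\<in>carrier V. s (\<phi> u)) \<in> dual_space R V"
  by (rule dual_spaceI)
    (use \<phi> in \<open>auto simp: linear_maps_def regular_module_def PiE_iff V_smult form_simps smult_as_mult\<close>)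

text \<open>As \<open>\<phi>\<close> is \<open>A\<close>-linear and \<open>s\<close> is symmetric,
  \<open>s(\<phi>(x\<^sup>\<or> u)) = s(\<phi>(u) x\<^sup>\<or>)\<close>, which is the coefficient of \<open>x\<close> in \<open>\<phi>(u)\<close>.  This is the
  source of the relative trace formula for the identity of a projective module.\<close>

lemma relative_trace_form_comp:
  assumes \<phi>: "\<phi> \<in> linear_maps A U (regular_module A)" and b: "b \<in> carrier U" and u: "u \<in> carrier U"
  shows "relative_trace (\<lambda>u\<in>carrier V. s (\<phi> u)) b u = \<phi> u \<odot>\<^bsub>U\<^esub> b"
proof -
  have \<phi>_closed: "\<phi> u \<in> carrier A"
    using \<phi> u by (auto simp: linear_maps_def regular_module_def)
  have \<phi>_act: "\<phi> (a \<odot>\<^bsub>U\<^esub> u) = a \<otimes>\<^bsub>A\<^esub> \<phi> u" if "a \<in> carrier A" for a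
    using \<phi> u that by (auto simp: linear_maps_def regular_module_def)
  have "relative_trace (\<lambda>u\<in>carrier V. s (\<phi> u)) b u =
      (\<Oplus>\<^bsub>V\<^esub>x\<in>X. (s (\<phi> u \<otimes>\<^bsub>A\<^esub> d x) \<odot>\<^bsub>A\<^esub> x) \<odot>\<^bsub>U\<^esub> b)"
    unfolding relative_trace_def
    by (rule V.M.finsum_cong')
      (use u b X_carrier d_carrier \<phi>_closed in
        \<open>auto simp: smult_act \<phi>_act form_simps form_symmetric[of "\<phi> u"]\<close>)
  also have "\<dots> = (\<Oplus>\<^bsub>A\<^esub>x\<in>X. s (\<phi> u \<otimes>\<^bsub>A\<^esub> d x) \<odot>\<^bsub>A\<^esub> x) \<odot>\<^bsub>U\<^esub> b"
    by (rule finsum_act[symmetric])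
      (use b X_carrier d_carrier \<phi>_closed in \<open>auto simp: form_simps\<close>)
  also have "\<dots> = \<phi> u \<odot>\<^bsub>U\<^esub> b"
    by (simp add: basis_expansion[OF \<phi>_closed])
  finally show ?thesis .
qed

end

section \<open>Projective modules\<close>

lemma (in ring) free_module_left_module: "left_module R (free_module R m)"
proof -
  have "abelian_group (free_module R m)"
  proof (rule abelian_groupI)
    show "\<exists>y\<in>carrier (free_module R m). y \<oplus>\<^bsub>free_module R m\<^esub> x = \<zero>\<^bsub>free_module R m\<^esub>"
      if "x \<in> carrier (free_module R m)" for x
      by (rule bexI[of _ "\<lambda>i\<in>{..<m}. \<ominus> x i"])
        (use that in \<open>auto simp: free_module_def l_neg PiE_iff\<close>)
  next
    fix x y z
    assume "x \<in> carrier (free_module R m)" "y \<in> carrier (free_module R m)"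
      "z \<in> carrier (free_module R m)"
    then show "x \<oplus>\<^bsub>free_module R m\<^esub> y \<oplus>\<^bsub>free_module R m\<^esub> z =
        x \<oplus>\<^bsub>free_module R m\<^esub> (y \<oplus>\<^bsub>free_module R m\<^esub> z)"
      by (auto simp: free_module_def a_assoc PiE_iff)
  next
    fix x y
    assume "x \<in> carrier (free_module R m)" "y \<in> carrier (free_module R m)"
    then show "x \<oplus>\<^bsub>free_module R m\<^esub> y = y \<oplus>\<^bsub>free_module R m\<^esub> x"
      by (auto simp: free_module_def a_comm PiE_iff)
  next
    fix x
    assume "x \<in> carrier (free_module R m)"
    then show "\<zero>\<^bsub>free_module R m\<^esub> \<oplus>\<^bsub>free_module R m\<^esub> x = x"
      by (auto simp: free_module_def PiE_iff extensional_def fun_eq_iff)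
  qed (auto simp: free_module_def PiE_iff)
  then show ?thesis
    by (auto intro!: left_module.intro left_module_axioms.intro ring_axioms
        simp: free_module_def PiE_iff l_distr r_distr m_assoc fun_eq_iff extensional_def)
qed

lemma (in left_module) submodule_finsum_closed:
  assumes H: "submodule H R M" and v: "v \<in> I \<rightarrow> H"
  shows "(\<Oplus>\<^bsub>M\<^esub>i\<in>I. v i) \<in> H"
proof -
  interpret H: submodule H R M by (rule H)
  have sub: "x \<in> carrier M" if "x \<in> H" for x
    using H.subset that by auto
  show ?thesis
    using v
  proof (induction I rule: infinite_finite_induct)
    case (insert i I)
    then show ?case
      using H.m_closed sub by (simp add: Pi_iff)
  qed (use H.one_closed in simp_all)
qed

text \<open>Split the standard basis vectors of the free module as \<open>e\<^sub>j = p\<^sub>j + q\<^sub>j\<close> with \<open>p\<^sub>j \<in> P\<close>, \<open>q\<^sub>j \<in> Q\<close>.  If \<open>f\<close>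
  identifies the module with \<open>P\<close>, then \<open>v\<^sub>j = f\<^sup>-\<^sup>1(p\<^sub>j)\<close> and the coordinates of \<open>f\<close> form a dual basis.\<close>

lemma (in left_module) fg_projective_dual_basis:
  assumes proj: "fg_projective R M"
  obtains m \<phi> v where "\<And>j. j < m \<Longrightarrow> \<phi> j \<in> linear_maps R M (regular_module R)"
    and "\<And>j. j < m \<Longrightarrow> v j \<in> carrier M"
    and "\<And>u. u \<in> carrier M \<Longrightarrow> (\<Oplus>\<^bsub>M\<^esub>j\<in>{..<m::nat}. \<phi> j u \<odot>\<^bsub>M\<^esub> v j) = u"
proof -
  obtain m P Q f where P: "submodule P R (free_module R m)" and Q: "submodule Q R (free_module R m)"
    and sum: "is_direct_sum (free_module R m) P Q"
    and f: "f \<in> linear_maps R M ((free_module R m)\<lparr>carrier := P\<rparr>)"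
    and bij: "bij_betw f (carrier M) P"
    using proj unfolding fg_projective_def by blast
  define L where "L = free_module R m"
  interpret L: left_module R L
    unfolding L_def by (rule free_module_left_module)
  interpret P: submodule P R L using P by (simp add: L_def)
  interpret Q: submodule Q R L using Q by (simp add: L_def)
  have P_carrier: "x \<in> carrier L" if "x \<in> P" for x
    using P.subset that by auto
  have Q_carrier: "x \<in> carrier L" if "x \<in> Q" for x
    using Q.subset that by auto
  have L_carrier: "carrier L = {..<m} \<rightarrow>\<^sub>E carrier R"
    and L_add: "(x \<oplus>\<^bsub>L\<^esub> y) = (\<lambda>i\<in>{..<m}. x i \<oplus> y i)"
    and L_smult: "(r \<odot>\<^bsub>L\<^esub> x) = (\<lambda>i\<in>{..<m}. r \<otimes> x i)" for x y r
    by (simp_all add: L_def free_module_def)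
  have f_P: "f u \<in> P" if "u \<in> carrier M" for u
    using bij that by (auto simp: bij_betw_def)
  have f_add: "f (u \<oplus>\<^bsub>M\<^esub> w) = f u \<oplus>\<^bsub>L\<^esub> f w" if "u \<in> carrier M" "w \<in> carrier M" for u w
    using f that by (auto simp: linear_maps_def L_def)
  have f_smult: "f (a \<odot>\<^bsub>M\<^esub> u) = a \<odot>\<^bsub>L\<^esub> f u" if "a \<in> carrier R" "u \<in> carrier M" for a u
    using f that by (auto simp: linear_maps_def L_def)
  have f_coord: "f u j \<in> carrier R" if "u \<in> carrier M" "j < m" for u j
    using P_carrier[OF f_P[OF that(1)]] that(2) by (auto simp: L_carrier)
  define e where "e j = (\<lambda>i\<in>{..<m}. if i = j then \<one> else \<zero>)" for j
  have e: "e j \<in> carrier L" for j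
    by (auto simp: L_carrier e_def)
  have expand: "(\<Oplus>\<^bsub>L\<^esub>j\<in>{..<m}. x j \<odot>\<^bsub>L\<^esub> e j) = x" if x: "x \<in> carrier L" for x
  proof
    fix k
    have xc: "x j \<in> carrier R" if "j < m" for j
      using x that by (auto simp: L_carrier)
    have xe: "x j \<odot>\<^bsub>L\<^esub> e j \<in> carrier L" if "j < m" for j
      by (rule L.smult_closed[OF xc[OF that] e])
    have sum_L: "(\<Oplus>\<^bsub>L\<^esub>j\<in>{..<m}. x j \<odot>\<^bsub>L\<^esub> e j) \<in> carrier L"
      by (rule L.M.finsum_closed) (use xe in auto)
    show "(\<Oplus>\<^bsub>L\<^esub>j\<in>{..<m}. x j \<odot>\<^bsub>L\<^esub> e j) k = x k"
    proof (cases "k < m")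
      case True
      have "(\<Oplus>\<^bsub>L\<^esub>j\<in>{..<m}. x j \<odot>\<^bsub>L\<^esub> e j) k = (\<Oplus>j\<in>{..<m}. (x j \<odot>\<^bsub>L\<^esub> e j) k)"
        by (rule additive_finsum[OF L.M.abelian_group_axioms R.abelian_group_axioms,
            where f = "\<lambda>x. x k"])
          (use True xe in \<open>auto simp: L_carrier L_add\<close>)
      also have "\<dots> = (\<Oplus>j\<in>{..<m}. if k = j then x j else \<zero>)"
        by (rule R.finsum_cong') (use True xc in \<open>auto simp: L_smult e_def\<close>)
      also have "\<dots> = x k"
        by (rule R.finsum_singleton) (use True xc in auto)
      finally show ?thesis .
    next
      case False
      then show ?thesis
        using sum_L x unfolding L_carrier by (simp add: PiE_iff extensional_def)
    qed
  qed
  have "\<exists>p q. p \<in> P \<and> q \<in> Q \<and> e j = p \<oplus>\<^bsub>L\<^esub> q" for j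
  proof -
    have "e j \<in> P <+>\<^bsub>L\<^esub> Q"
      using sum e by (simp add: is_direct_sum_def L_def)
    then show ?thesis
      by (auto simp: set_add_def')
  qed
  then obtain p q where p: "p j \<in> P" and q: "q j \<in> Q" and pq: "e j = p j \<oplus>\<^bsub>L\<^esub> q j" for j
    by metis
  define v where "v j = inv_into (carrier M) f (p j)" for j
  have v: "v j \<in> carrier M" and f_v: "f (v j) = p j" for j
  proof -
    have "p j \<in> f ` carrier M"
      using bij p by (simp add: bij_betw_def)
    then show "v j \<in> carrier M" and "f (v j) = p j"
      unfolding v_def by (simp_all add: inv_into_into f_inv_into_f)
  qed
  have decompose: "(\<Oplus>\<^bsub>M\<^esub>j\<in>{..<m}. f u j \<odot>\<^bsub>M\<^esub> v j) = u" if u: "u \<in> carrier M" for u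
  proof -
    let ?p = "\<Oplus>\<^bsub>L\<^esub>j\<in>{..<m}. f u j \<odot>\<^bsub>L\<^esub> p j" and ?q = "\<Oplus>\<^bsub>L\<^esub>j\<in>{..<m}. f u j \<odot>\<^bsub>L\<^esub> q j"
    have p_P: "?p \<in> P"
      by (rule L.submodule_finsum_closed[OF P.submodule_axioms]) (use u f_coord p in auto)
    have q_Q: "?q \<in> Q"
      by (rule L.submodule_finsum_closed[OF Q.submodule_axioms]) (use u f_coord q in auto)
    have "f u = (\<Oplus>\<^bsub>L\<^esub>j\<in>{..<m}. f u j \<odot>\<^bsub>L\<^esub> e j)"
      using expand[OF P_carrier[OF f_P[OF u]]] by simp
    also have "\<dots> = (\<Oplus>\<^bsub>L\<^esub>j\<in>{..<m}. f u j \<odot>\<^bsub>L\<^esub> p j \<oplus>\<^bsub>L\<^esub> f u j \<odot>\<^bsub>L\<^esub> q j)"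
      by (rule L.M.finsum_cong')
        (use u f_coord p q P_carrier Q_carrier in \<open>auto simp: pq L.smult_r_distr\<close>)
    also have "\<dots> = ?p \<oplus>\<^bsub>L\<^esub> ?q"
      by (rule L.M.finsum_addf) (use u f_coord p q P_carrier Q_carrier in auto)
    finally have fu: "f u = ?p \<oplus>\<^bsub>L\<^esub> ?q" .
    \<comment> \<open>The \<open>Q\<close>-component of \<open>f u\<close> vanishes because \<open>f u\<close> and its \<open>P\<close>-component both lie in \<open>P\<close>.\<close>
    have "?q = \<ominus>\<^bsub>L\<^esub> ?p \<oplus>\<^bsub>L\<^esub> (?p \<oplus>\<^bsub>L\<^esub> ?q)"
      using P_carrier[OF p_P] Q_carrier[OF q_Q] by (simp add: L.M.r_neg1)
    also have "\<dots> = \<ominus>\<^bsub>L\<^esub> ?p \<oplus>\<^bsub>L\<^esub> f u"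
      by (rule arg_cong[OF fu[symmetric]])
    also have "\<dots> \<in> P"
      using P.m_closed[OF P.m_inv_closed[OF p_P] f_P[OF u]] by (simp add: a_inv_def)
    finally have "?q \<in> P \<inter> Q"
      using q_Q by simp
    moreover have "P \<inter> Q = {\<zero>\<^bsub>L\<^esub>}"
      using sum by (simp add: is_direct_sum_def L_def)
    ultimately have "?q = \<zero>\<^bsub>L\<^esub>"
      by blast
    then have "?p \<oplus>\<^bsub>L\<^esub> ?q = ?p"
      using P_carrier[OF p_P] by simp
    with fu have "f u = ?p"
      by (rule trans)
    also have "\<dots> = (\<Oplus>\<^bsub>L\<^esub>j\<in>{..<m}. f (f u j \<odot>\<^bsub>M\<^esub> v j))"
      by (rule L.M.finsum_cong')
        (use u f_coord P_carrier[OF p] v in \<open>auto simp: f_smult f_v\<close>)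
    also have "\<dots> = f (\<Oplus>\<^bsub>M\<^esub>j\<in>{..<m}. f u j \<odot>\<^bsub>M\<^esub> v j)"
      by (rule additive_finsum[OF M.abelian_group_axioms L.M.abelian_group_axioms, symmetric])
        (use u f_coord v f_P P_carrier in \<open>auto simp: f_add\<close>)
    finally have "f (\<Oplus>\<^bsub>M\<^esub>j\<in>{..<m}. f u j \<odot>\<^bsub>M\<^esub> v j) = f u" ..
    moreover have "(\<Oplus>\<^bsub>M\<^esub>j\<in>{..<m}. f u j \<odot>\<^bsub>M\<^esub> v j) \<in> carrier M"
      by (rule M.finsum_closed) (use u f_coord v in auto)
    ultimately show ?thesis
      using inj_onD[OF bij_betw_imp_inj_on[OF bij]] u by blast
  qed
  show thesis
  proof (rule that[of m "\<lambda>j. \<lambda>u\<in>carrier M. f u j" v])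
    show "(\<lambda>u\<in>carrier M. f u j) \<in> linear_maps R M (regular_module R)" if "j < m" for j
      using that f_coord
      by (auto simp: linear_maps_def regular_module_def f_add f_smult L_add L_smult)
  qed (use v decompose in \<open>auto simp: restrict_def\<close>)
qed

section \<open>Divisibility of ranks\<close>

context symmetrised_algebra_module
begin

text \<open>Average \<open>u \<mapsto> l(u) b\<close> for a basis element \<open>b\<close> and its coordinate form \<open>l\<close>: this is an endomorphism of the
  lattice with trace \<open>r l(b) = r\<close>.\<close>

lemma knorr_rank_divides:
  assumes r: "r \<in> carrier R" and z: "(\<Oplus>\<^bsub>A\<^esub>x\<in>X. x \<otimes>\<^bsub>A\<^esub> d x) = r \<odot>\<^bsub>A\<^esub> \<one>\<^bsub>A\<^esub>"
    and U: "knorr_lattice R A U"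
  shows "[lattice_rank R A U] \<cdot>\<^bsub>R\<^esub> \<one> divides r"
proof -
  have free: "free_of_finite_rank R V" and nz: "carrier V \<noteq> {\<zero>\<^bsub>V\<^esub>}"
    using U by (simp_all add: knorr_lattice_def lattice_over_def indecomposable_module_def)
  let ?B = "some_basis R V"
  have B: "is_basis R V ?B"
    by (rule V.some_basis_is_basis[OF free])
  have "?B \<noteq> {}"
    using V.rank_pos[OF free nz] by (auto simp: rank_def)
  then obtain b where b: "b \<in> ?B" by auto
  then have b': "b \<in> carrier U"
    using B by (auto simp: is_basis_def)
  let ?l = "\<lambda>v\<in>carrier V. coords R V ?B v b"
  have l: "?l \<in> dual_space R V"
    by (rule V.coords_in_dual_space[OF B b])
  let ?T = "restrict (relative_trace ?l b) (carrier U)"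
  have "linear_trace R V ?T = ?l ((r \<odot>\<^bsub>A\<^esub> \<one>\<^bsub>A\<^esub>) \<odot>\<^bsub>U\<^esub> b)"
    using linear_trace_relative_trace[OF l b' free, of ?T] by (simp add: z)
  also have "\<dots> = r \<otimes> ?l b"
    using dual_spaceD(3)[OF l r, of b] b' by (simp add: V_smult)
  also have "?l b = \<one>"
    using b' V.coords_basis_element[OF B b b] by simp
  finally have "linear_trace R V ?T = r"
    by (simp only: R.r_one[OF r])
  then have "PIdl r \<subseteq> PIdl ([lattice_rank R A U] \<cdot>\<^bsub>R\<^esub> \<one>)"
    using U relative_trace_linear[OF l b'] unfolding knorr_lattice_def Let_def by metis
  then show ?thesis
    using R.to_contain_is_to_divide r by simp
qed

text \<open>The rank is the trace of the identity, which is a sum of relative traces of rank one maps; each of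
  these has its trace in \<open>r R\<close>.\<close>

lemma divides_projective_rank:
  assumes r: "r \<in> carrier R" and z: "(\<Oplus>\<^bsub>A\<^esub>x\<in>X. x \<otimes>\<^bsub>A\<^esub> d x) = r \<odot>\<^bsub>A\<^esub> \<one>\<^bsub>A\<^esub>"
    and U: "lattice_over R A U" and proj: "fg_projective A U"
  shows "r divides [lattice_rank R A U] \<cdot>\<^bsub>R\<^esub> \<one>"
proof -
  have free: "free_of_finite_rank R V"
    using U by (simp add: lattice_over_def)
  obtain m \<phi> v where \<phi>: "\<And>j. j < m \<Longrightarrow> \<phi> j \<in> linear_maps A U (regular_module A)"
    and v: "\<And>j. j < m \<Longrightarrow> v j \<in> carrier U"
    and id: "\<And>u. u \<in> carrier U \<Longrightarrow> (\<Oplus>\<^bsub>U\<^esub>j\<in>{..<m::nat}. \<phi> j u \<odot>\<^bsub>U\<^esub> v j) = u"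
    using U.fg_projective_dual_basis[OF proj] by blast
  let ?l = "\<lambda>j. \<lambda>u\<in>carrier V. s (\<phi> j u)"
  have l: "?l j \<in> dual_space R V" if "j < m" for j
    by (rule form_comp_in_dual_space[OF \<phi>[OF that]])
  have l_v: "?l j (v j) \<in> carrier R" if "j < m" for j
    using dual_spaceD(1)[OF l[OF that], of "v j"] v[OF that] by simp
  have \<phi>_closed: "\<phi> j u \<in> carrier A" if "j < m" "u \<in> carrier U" for j u
    using \<phi>[OF that(1)] that(2) by (auto simp: linear_maps_def regular_module_def)
  have id': "u = (\<Oplus>\<^bsub>V\<^esub>j\<in>{..<m}. relative_trace (?l j) (v j) u)" if u: "u \<in> carrier U" for u
  proof -
    have "u = (\<Oplus>\<^bsub>U\<^esub>j\<in>{..<m}. \<phi> j u \<odot>\<^bsub>U\<^esub> v j)"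
      using id[OF u] by simp
    also have "\<dots> = (\<Oplus>\<^bsub>V\<^esub>j\<in>{..<m}. \<phi> j u \<odot>\<^bsub>U\<^esub> v j)"
      by (rule additive_finsum[OF U.M.abelian_group_axioms V.M.abelian_group_axioms,
          where f = "\<lambda>x. x"])
        (use u v \<phi>_closed in auto)
    also have "\<dots> = (\<Oplus>\<^bsub>V\<^esub>j\<in>{..<m}. relative_trace (?l j) (v j) u)"
      by (rule V.M.finsum_cong')
        (use u v \<phi> relative_trace_closed[OF l] relative_trace_form_comp[OF \<phi>] in auto)
    finally show ?thesis .
  qed
  have tr: "linear_trace R V (relative_trace (?l j) (v j)) = r \<otimes> ?l j (v j)" if j: "j < m" for j
  proof -
    have "linear_trace R V (relative_trace (?l j) (v j)) = ?l j ((r \<odot>\<^bsub>A\<^esub> \<one>\<^bsub>A\<^esub>) \<odot>\<^bsub>U\<^esub> v j)"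
      using linear_trace_relative_trace[OF l[OF j] v[OF j] free] by (simp add: z)
    also have "\<dots> = r \<otimes> ?l j (v j)"
      using dual_spaceD(3)[OF l[OF j] r, of "v j"] v[OF j] by (simp add: V_smult)
    finally show ?thesis .
  qed
  have "[lattice_rank R A U] \<cdot>\<^bsub>R\<^esub> \<one> = linear_trace R V (\<lambda>u. u)"
    unfolding lattice_rank_def by (rule V.linear_trace_identity[OF free, symmetric]) simp
  also have "\<dots> = (\<Oplus>j\<in>{..<m}. linear_trace R V (relative_trace (?l j) (v j)))"
  proof (rule V.linear_trace_finsum[OF free])
    show "u = (\<Oplus>\<^bsub>V\<^esub>j\<in>{..<m}. relative_trace (?l j) (v j) u)" if "u \<in> carrier V" for u
      using that by (intro id') simp
    show "relative_trace (?l j) (v j) u \<in> carrier V" if "j \<in> {..<m}" "u \<in> carrier V" for j u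
      using relative_trace_closed[OF l v] that by simp
  qed simp
  also have "\<dots> = (\<Oplus>j\<in>{..<m}. r \<otimes> ?l j (v j))"
    by (rule R.finsum_cong') (use tr r l_v in auto)
  also have "\<dots> = r \<otimes> (\<Oplus>j\<in>{..<m}. ?l j (v j))"
    by (rule R.finsum_rdistr[symmetric]) (use r l_v in auto)
  finally have "[lattice_rank R A U] \<cdot>\<^bsub>R\<^esub> \<one> = r \<otimes> (\<Oplus>j\<in>{..<m}. ?l j (v j))" .
  moreover have "(\<Oplus>j\<in>{..<m}. ?l j (v j)) \<in> carrier R"
    by (rule R.finsum_closed) (use l_v in auto)
  ultimately show ?thesis
    unfolding factor_def by blast
qed

end

section \<open>Integers in the ground ring\<close>

lemma (in ring) add_pow_mult_one:
  fixes k m :: nat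
  shows "[(k * m)] \<cdot> \<one> = ([k] \<cdot> \<one>) \<otimes> ([m] \<cdot> \<one>)"
proof -
  have "([k] \<cdot> \<one>) \<otimes> ([m] \<cdot> \<one>) = [k] \<cdot> (\<one> \<otimes> ([m] \<cdot> \<one>))"
    by (rule add_pow_ldistr) simp_all
  also have "\<dots> = [(m * k)] \<cdot> \<one>"
    by (simp add: add.nat_pow_pow)
  finally show ?thesis
    by (simp add: mult.commute)
qed

text \<open>A nonzero nonunit has an irreducible divisor, whose principal ideal is maximal and hence is the
  unique one.\<close>

lemma (in principal_domain) unit_if_not_in_unique_maximalideal:
  assumes unique: "\<exists>!I. maximalideal I R" and max: "maximalideal M R"
    and a: "a \<in> carrier R" "a \<notin> M"
  shows "a \<in> Units R"
proof (rule ccontr)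
  assume nonunit: "a \<notin> Units R"
  interpret M: maximalideal M R by (rule max)
  have "a \<noteq> \<zero>"
    using a(2) M.zero_closed by auto
  then have "a \<in> carrier R - {\<zero>}"
    using a(1) by simp
  from this nonunit obtain b where b: "b \<in> carrier R" "ring_irreducible b" "b divides a"
    by (rule exists_irreducible_divisor)
  have "PIdl b = M"
    using irreducible_imp_maximalideal[OF b(1,2)] max unique by blast
  moreover have "a \<in> PIdl b"
    using to_contain_is_to_divide[OF b(1) a(1)] b(3) cgenideal_self[OF a(1)] by blast
  ultimately show False
    using a(2) by simp
qed

context modular_system
begin

lemma principal_domain_R: "principal_domain R"
  using dvr by (simp add: discrete_valuation_ring_def)

text \<open>The image of \<open>m\<close> in the residue field is nonzero, so \<open>m\<close> lies outside the maximal ideal.\<close>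

lemma prime_to_p_unit:
  assumes m: "\<not> p dvd m"
  shows "[m] \<cdot>\<^bsub>R\<^esub> \<one>\<^bsub>R\<^esub> \<in> Units R"
proof -
  interpret R: principal_domain R by (rule principal_domain_R)
  define I where "I = PIdl\<^bsub>R\<^esub> \<pi>"
  have zero: "\<zero>\<^bsub>R Quot I\<^esub> = I"
    by (simp add: FactRing_def)
  interpret I: maximalideal I R
    unfolding I_def by (rule uniformiser)
  interpret h: ring_hom_ring R "R Quot I" "(+>\<^bsub>R\<^esub>) I"
    by (rule I.rcos_ring_hom_ring)
  have pow: "I +>\<^bsub>R\<^esub> ([k] \<cdot>\<^bsub>R\<^esub> \<one>\<^bsub>R\<^esub>) = [k] \<cdot>\<^bsub>R Quot I\<^esub> \<one>\<^bsub>R Quot I\<^esub>" for k :: nat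
  proof (induction k)
    case 0
    show ?case
      by (simp only: R.add.nat_pow_0 h.S.add.nat_pow_0 h.hom_zero)
  next
    case (Suc k)
    have "I +>\<^bsub>R\<^esub> ([k] \<cdot>\<^bsub>R\<^esub> \<one>\<^bsub>R\<^esub> \<oplus>\<^bsub>R\<^esub> \<one>\<^bsub>R\<^esub>) =
        (I +>\<^bsub>R\<^esub> ([k] \<cdot>\<^bsub>R\<^esub> \<one>\<^bsub>R\<^esub>)) \<oplus>\<^bsub>R Quot I\<^esub> (I +>\<^bsub>R\<^esub> \<one>\<^bsub>R\<^esub>)"
      by (rule h.hom_add) simp_all
    then show ?case
      by (simp only: R.add.nat_pow_Suc h.S.add.nat_pow_Suc Suc.IH h.hom_one)
  qed
  have "[m] \<cdot>\<^bsub>R\<^esub> \<one>\<^bsub>R\<^esub> \<notin> I"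
  proof
    assume "[m] \<cdot>\<^bsub>R\<^esub> \<one>\<^bsub>R\<^esub> \<in> I"
    then have "I +>\<^bsub>R\<^esub> ([m] \<cdot>\<^bsub>R\<^esub> \<one>\<^bsub>R\<^esub>) = \<zero>\<^bsub>R Quot I\<^esub>"
      unfolding zero by (rule I.a_rcos_const)
    then have "p dvd m"
      using residue_char unfolding has_characteristic_def I_def[symmetric] pow by blast
    then show False
      using m by simp
  qed
  moreover have "\<exists>!J. maximalideal J R"
    using dvr unfolding discrete_valuation_ring_def by blast
  ultimately show ?thesis
    by (intro R.unit_if_not_in_unique_maximalideal[OF _ I.maximalideal_axioms]) simp_all
qed

lemma integer_associated_p_part:
  assumes "m > 0"
  shows "([p_part p m] \<cdot>\<^bsub>R\<^esub> \<one>\<^bsub>R\<^esub>) \<sim>\<^bsub>R\<^esub> ([m] \<cdot>\<^bsub>R\<^esub> \<one>\<^bsub>R\<^esub>)"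
proof -
  interpret R: principal_domain R by (rule principal_domain_R)
  have "\<not> is_unit p"
    using prime_p not_prime_unit by blast
  then obtain k where m: "m = p_part p m * k" and k: "\<not> p dvd k"
    unfolding p_part_def using multiplicity_decompose'[of m p] assms by blast
  have eq: "[m] \<cdot>\<^bsub>R\<^esub> \<one>\<^bsub>R\<^esub> = ([p_part p m] \<cdot>\<^bsub>R\<^esub> \<one>\<^bsub>R\<^esub>) \<otimes>\<^bsub>R\<^esub> ([k] \<cdot>\<^bsub>R\<^esub> \<one>\<^bsub>R\<^esub>)"
    by (rule R.add_pow_mult_one[of "p_part p m" k, folded m])
  have "([m] \<cdot>\<^bsub>R\<^esub> \<one>\<^bsub>R\<^esub>) \<sim>\<^bsub>R\<^esub> ([p_part p m] \<cdot>\<^bsub>R\<^esub> \<one>\<^bsub>R\<^esub>)"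
    by (rule R.associatedI2[OF prime_to_p_unit[OF k] eq]) simp
  then show ?thesis
    by (rule R.associated_sym)
qed

end

theorem proposition1p9:
  fixes p n :: nat and \<pi> :: 'o and R :: "'o ring" and K :: "'k ring" and \<iota> :: "'o \<Rightarrow> 'k"
    and A :: "('o, 'a) module" and s :: "'a \<Rightarrow> 'o"
  assumes "modular_system p \<pi> R K \<iota>"
    and "symmetric_algebra R A"
    and "split_semisimple K (scalar_extension R K \<iota> A)"
    and "projective_scalar_property R A"
    and "symmetrising_form R A s"
    and "relative_projective_element R A s ((\<pi> [^]\<^bsub>R\<^esub> n) \<odot>\<^bsub>A\<^esub> \<one>\<^bsub>A\<^esub>)"
  shows "(\<forall>U :: ('a, 'u) module. knorr_lattice R A U \<longrightarrow>
            ([p_part p (lattice_rank R A U)] \<cdot>\<^bsub>R\<^esub> \<one>\<^bsub>R\<^esub>) divides\<^bsub>R\<^esub> (\<pi> [^]\<^bsub>R\<^esub> n)) \<and>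
         (\<forall>U :: ('a, 'v) module.
            lattice_over R A U \<and> carrier U \<noteq> {\<zero>\<^bsub>U\<^esub>} \<and> fg_projective A U \<longrightarrow>
            (\<pi> [^]\<^bsub>R\<^esub> n) divides\<^bsub>R\<^esub> ([p_part p (lattice_rank R A U)] \<cdot>\<^bsub>R\<^esub> \<one>\<^bsub>R\<^esub>))"
proof -
  interpret modular_system p \<pi> R K \<iota> by (rule assms(1))
  interpret R: principal_domain R by (rule principal_domain_R)
  interpret A: assoc_algebra R A
    using assms(2) by (simp add: symmetric_algebra_def)
  obtain X d where basis: "is_basis R A X" and dual: "is_dual_basis R A s X d"
    and z: "(\<Oplus>\<^bsub>A\<^esub>x\<in>X. x \<otimes>\<^bsub>A\<^esub> d x) = (\<pi> [^]\<^bsub>R\<^esub> n) \<odot>\<^bsub>A\<^esub> \<one>\<^bsub>A\<^esub>"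
    using assms(6) unfolding relative_projective_element_def by metis
  have alg: "symmetrised_algebra R A s X d"
    by (intro symmetrised_algebra.intro symmetrised_algebra_axioms.intro
        A.assoc_algebra_axioms A.ring_axioms R.cring_axioms assms(5) basis dual)
  have \<pi>n: "\<pi> [^]\<^bsub>R\<^esub> n \<in> carrier R"
    using uniformiser_closed by simp
  have p_part: "([p_part p (lattice_rank R A U)] \<cdot>\<^bsub>R\<^esub> \<one>\<^bsub>R\<^esub>) \<sim>\<^bsub>R\<^esub> ([lattice_rank R A U] \<cdot>\<^bsub>R\<^esub> \<one>\<^bsub>R\<^esub>)"
    if U: "symmetrised_algebra_module R A s X d U"
      and lattice: "lattice_over R A U" and nonzero: "carrier U \<noteq> {\<zero>\<^bsub>U\<^esub>}"
    for U :: "('a, 'w) module"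
  proof -
    interpret U: symmetrised_algebra_module R A s X d U by (rule U)
    show ?thesis
      using U.V.rank_pos integer_associated_p_part lattice nonzero
      by (simp add: lattice_over_def lattice_rank_def)
  qed
  have module: "symmetrised_algebra_module R A s X d U" if "lattice_over R A U"
    for U :: "('a, 'w) module"
    using that alg
    by (intro symmetrised_algebra_module.intro algebra_module.intro)
      (simp_all add: lattice_over_def symmetrised_algebra_def)
  show ?thesis
  proof (intro conjI allI impI)
    fix U :: "('a, 'u) module"
    assume U: "knorr_lattice R A U"
    then have lattice: "lattice_over R A U" and nonzero: "carrier U \<noteq> {\<zero>\<^bsub>U\<^esub>}"
      by (simp_all add: knorr_lattice_def indecomposable_module_def)
    interpret U: symmetrised_algebra_module R A s X d U by (rule module[OF lattice])
    show "([p_part p (lattice_rank R A U)] \<cdot>\<^bsub>R\<^esub> \<one>\<^bsub>R\<^esub>) divides\<^bsub>R\<^esub> (\<pi> [^]\<^bsub>R\<^esub> n)"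
      using R.divides_cong_l[OF p_part[OF module[OF lattice] lattice nonzero]]
        U.knorr_rank_divides[OF \<pi>n z U] \<pi>n by simp
  next
    fix U :: "('a, 'v) module"
    assume "lattice_over R A U \<and> carrier U \<noteq> {\<zero>\<^bsub>U\<^esub>} \<and> fg_projective A U"
    then have lattice: "lattice_over R A U" and nonzero: "carrier U \<noteq> {\<zero>\<^bsub>U\<^esub>}"
      and proj: "fg_projective A U" by simp_all
    interpret U: symmetrised_algebra_module R A s X d U by (rule module[OF lattice])
    show "(\<pi> [^]\<^bsub>R\<^esub> n) divides\<^bsub>R\<^esub> ([p_part p (lattice_rank R A U)] \<cdot>\<^bsub>R\<^esub> \<one>\<^bsub>R\<^esub>)"
      using R.divides_cong_r[OF _ R.associated_sym[OF p_part[OF module[OF lattice] lattice nonzero]]]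
        U.divides_projective_rank[OF \<pi>n z lattice proj] \<pi>n by simp
  qed
qed

end
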